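(* Fix $p\in(0,1]$. For each $n\geq 1$, choose a Coxeter element $c^{(n)}$ of the Coxeter group $A_n$. Then, as $n\to\infty$, \[\mathcal E\left(\mathrm{Camb}_{c^{(n)}}\right)\leq \frac{1}{p}\left(2+2\sqrt{1-p}\right)n+o(n).\]
   Context: $A_n$ is the symmetric group $S_{n+1}$ with simple reflections $s_i=(i\ i+1)$, $i\in[n]$. For a finite Coxeter group $W$ with simple reflections $S$, a Coxeter element is a product $c=s_{i_1}\cdots s_{i_r}$ of all simple reflections, each exactly once, in some order; fix such a word $\mathsf c$. The right weak order on $W$: $u\le v$ if some reduced word for $v$ has a reduced word for $u$ as a prefix. The $\mathsf c$-sorting word of $w\in W$ is the reduced word for $w$ that is lexicographically first (by positions) among reduced words for $w$ occurring as subwords of $\mathsf c^\infty=\mathsf c\mathsf c\mathsf c\cdots$; writing it as $\mathsf w^{\langle1\rangle}\mathsf w^{\langle2\rangle}\cdots$, where $\mathsf w^{\langle i\rangle}$ is the part taken from the $i$-th copy of $\mathsf c$, $w$ is $c$-sortable if the sets of letters of $\mathsf w^{\langle1\rangle},\mathsf w^{\langle2\rangle},\ldots$ form a weakly decreasing chain under inclusion (this depends only on $c$). The $c$-Cambrian lattice $\mathrm{Camb}_c$ is the set of $c$-sortable elements under the weak order (a lattice). For a finite lattice $L$, the Ungarian Markov chain (with fixed probability $p$) moves from $x$ to $\bigwedge(\{x\}\cup T)$, where $T$ contains each element covered by $x$ independently with probability $p$; $\mathcal E(L)$ is the expected number of steps from the top element to the bottom element. *)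

theory Defs
  imports
    "HOL-Algebra.Lattice"
    "HOL-Combinatorics.Permutations"
    "HOL-Library.Sublist"
    "HOL-Library.Landau_Symbols"
    "HOL-Probability.Probability"
begin

section \<open>The Coxeter group of type A\<close>

text \<open>The group of type \<open>A\<^sub>n\<close> is the set of permutations of \<open>{1..n + 1}\<close>, represented as functions
  on \<open>nat\<close> that fix every point outside \<open>{1..n + 1}\<close>. The letter \<open>i\<close> of a word stands for the
  simple reflection \<open>(i i+1)\<close>.\<close>

definition symmetric_group :: "nat \<Rightarrow> (nat \<Rightarrow> nat) set" where
  "symmetric_group n = {w. w permutes {1..n + 1}}"

definition word_prod :: "nat list \<Rightarrow> nat \<Rightarrow> nat" where
  "word_prod a = foldr (\<lambda>i w. Transposition.transpose i (i + 1) \<circ> w) a id"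

definition words_for :: "nat \<Rightarrow> (nat \<Rightarrow> nat) \<Rightarrow> nat list set" where
  "words_for n w = {a. set a \<subseteq> {1..n} \<and> word_prod a = w}"

definition reduced_words :: "nat \<Rightarrow> (nat \<Rightarrow> nat) \<Rightarrow> nat list set" where
  "reduced_words n w = {a \<in> words_for n w. \<forall>b \<in> words_for n w. length a \<le> length b}"

definition right_weak_le :: "nat \<Rightarrow> (nat \<Rightarrow> nat) \<Rightarrow> (nat \<Rightarrow> nat) \<Rightarrow> bool" where
  "right_weak_le n u v \<longleftrightarrow> (\<exists>a \<in> reduced_words n u. \<exists>b \<in> reduced_words n v. prefix a b)"

definition coxeter_words :: "nat \<Rightarrow> (nat \<Rightarrow> nat) \<Rightarrow> nat list set" where
  "coxeter_words n c = {cs. distinct cs \<and> set cs = {1..n} \<and> word_prod cs = c}"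

definition coxeter_elements :: "nat \<Rightarrow> (nat \<Rightarrow> nat) set" where
  "coxeter_elements n = {c. coxeter_words n c \<noteq> {}}"


section \<open>Sorting words and Cambrian lattices\<close>

text \<open>A subword of \<open>cs cs cs \<dots>\<close> is given by its list \<open>ks\<close> of positions, in increasing order.
  Positions are counted from 0, so position \<open>k\<close> lies in copy number \<open>k div length cs\<close> of \<open>cs\<close>,
  where the copies are also counted from 0.\<close>

definition letter_at :: "nat list \<Rightarrow> nat \<Rightarrow> nat" where
  "letter_at cs k = cs ! (k mod length cs)"

definition reduced_subwords :: "nat \<Rightarrow> nat list \<Rightarrow> (nat \<Rightarrow> nat) \<Rightarrow> nat list set" where
  "reduced_subwords n cs w =
    {ks. sorted_wrt (<) ks \<and> map (letter_at cs) ks \<in> reduced_words n w}"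

definition is_sorting_word :: "nat \<Rightarrow> nat list \<Rightarrow> (nat \<Rightarrow> nat) \<Rightarrow> nat list \<Rightarrow> bool" where
  "is_sorting_word n cs w ks \<longleftrightarrow> ks \<in> reduced_subwords n cs w \<and>
    (\<forall>ls \<in> reduced_subwords n cs w. ls = ks \<or> (ks, ls) \<in> lexord less_than)"

definition block_letters :: "nat list \<Rightarrow> nat list \<Rightarrow> nat \<Rightarrow> nat set" where
  "block_letters cs ks i = letter_at cs ` {k \<in> set ks. k div length cs = i}"

definition sortable :: "nat \<Rightarrow> nat list \<Rightarrow> (nat \<Rightarrow> nat) \<Rightarrow> bool" where
  "sortable n cs w \<longleftrightarrow> w \<in> symmetric_group n \<and>
    (\<exists>ks. is_sorting_word n cs w ks \<and>
          (\<forall>i. block_letters cs ks (Suc i) \<subseteq> block_letters cs ks i))"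

definition Camb :: "nat \<Rightarrow> nat list \<Rightarrow> (nat \<Rightarrow> nat) gorder" where
  "Camb n cs = \<lparr>carrier = {w. sortable n cs w}, eq = (=), le = right_weak_le n\<rparr>"


section \<open>Ungarian Markov chains\<close>

definition lower_covers :: "('a, 'b) gorder_scheme \<Rightarrow> 'a \<Rightarrow> 'a set" where
  "lower_covers L x =
    {y \<in> carrier L. y \<sqsubset>\<^bsub>L\<^esub> x \<and> \<not> (\<exists>z \<in> carrier L. y \<sqsubset>\<^bsub>L\<^esub> z \<and> z \<sqsubset>\<^bsub>L\<^esub> x)}"

text \<open>The chain is driven by independent Bernoulli variables with parameter \<open>p\<close>, one for each pair
  of a time \<open>t\<close> and an element \<open>y\<close>: the variable at \<open>(t, y)\<close> decides whether \<open>y\<close> is put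
  into the random set \<open>T\<close> of step \<open>t\<close>, if \<open>y\<close> is covered by the current state. Coins of different
  times are independent, so this process is a Markov chain with the Ungarian transition
  probabilities.\<close>

definition coin_space :: "real \<Rightarrow> (nat \<times> 'a \<Rightarrow> bool) measure" where
  "coin_space p = (\<Pi>\<^sub>M ty \<in> UNIV. measure_pmf (bernoulli_pmf p))"

primrec ungarian_chain ::
  "('a, 'b) gorder_scheme \<Rightarrow> nat \<Rightarrow> (nat \<times> 'a \<Rightarrow> bool) \<Rightarrow> 'a" where
  "ungarian_chain L 0 \<omega> = \<top>\<^bsub>L\<^esub>"
| "ungarian_chain L (Suc t) \<omega> =
    (let x = ungarian_chain L t \<omega>; T = {y \<in> lower_covers L x. \<omega> (t, y)}
     in \<Sqinter>\<^bsub>L\<^esub> ({x} \<union> T))"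

text \<open>The value is \<open>\<infinity>\<close> if the bottom element is never reached (the infimum of the empty set).\<close>

definition steps_to_bottom ::
  "('a, 'b) gorder_scheme \<Rightarrow> (nat \<times> 'a \<Rightarrow> bool) \<Rightarrow> ennreal" where
  "steps_to_bottom L \<omega> = (INF t \<in> {t. ungarian_chain L t \<omega> = \<bottom>\<^bsub>L\<^esub>}. of_nat t)"

definition expected_steps :: "real \<Rightarrow> ('a, 'b) gorder_scheme \<Rightarrow> ennreal" where
  "expected_steps p L = (\<integral>\<^sup>+ \<omega>. steps_to_bottom L \<omega> \<partial>coin_space p)"

end

theory Submission
  imports Defs
begin

text \<open>
  An element of the Cambrian lattice is determined by its inversion set. Label an inner entry \<open>b\<close>
  lower if \<open>s\<^bsub>b-1\<^esub>\<close> precedes \<open>s\<^bsub>b\<^esub>\<close> in the Coxeter word, and upper otherwise. Scanning the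
  greedy sorting word letter by letter shows that sortable means: an inversion \<open>(a, c)\<close> with
  \<open>a < b < c\<close> forces the inversion \<open>(a, b)\<close> if \<open>b\<close> is lower and \<open>(b, c)\<close> if \<open>b\<close> is upper.
  Together with transitivity this condition is closed under intersection, so meets are intersections.

  Order the inversions by two coordinates so that they form a subset of an \<open>n \<times> n\<close> square. Deleting
  a maximal inversion of \<open>x\<close> gives an element covered by \<open>x\<close>, so in each step every maximal inversion
  is deleted independently with probability at least \<open>p\<close>. Hence the mean last-passage time with
  geometric weights over the inversion set drops by at least one per step in expectation, and it
  bounds the expected time to the bottom.

  Adding boundary weights of parameter \<open>1 - sqrt(1 - p)\<close> makes last-passage percolation on the square
  stationary (Burke's theorem), and the passage time to the corner then has mean
  \<open>2n / (1 - sqrt(1 - p)) = (2 + 2 sqrt(1 - p)) n / p\<close>, with no error term.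
\<close>

section \<open>Reduced words and inversion sets\<close>

text \<open>The coordinates put \<open>(a, c)\<close> strictly between \<open>(a, b)\<close> and
  \<open>(b, c)\<close> for all \<open>a < b < c\<close>, with \<open>(a, b)\<close> smallest if
  \<open>b\<close> is lower and \<open>(b, c)\<close> smallest if \<open>b\<close> is upper.
  Alignment then demands only smaller pairs, and transitivity only yields a pair below one of its
  premises, so deleting a maximal pair breaks neither. Covers of any other kind only push the chain
  further down. A weight counts the coin tosses until its pair, once maximal, is deleted. By
  memorylessness one step of the chain takes one unit off every maximal weight. Write
  \<open>a = sqrt (1 - p)\<close>. Bulk weights have density proportional to
  \<open>(a\<^sup>2) ^ w\<close>, and stationarity asks for boundary densities \<open>u ^ I\<close>
  and \<open>v ^ J\<close> with \<open>u * v = a\<^sup>2\<close>; on a square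
  \<open>u = v = a\<close> gives the least bound. A boundary weight has mean
  \<open>a / (1 - a)\<close>, counting tosses instead of failures adds one, and so each of the
  \<open>2 * n\<close> steps to the corner costs \<open>1 / (1 - a)\<close>, where
  \<open>(1 - a) * (1 + a) = p\<close>.\<close>

declare One_nat_def [simp del]

text \<open>Pairs of entries rather than of positions: a new first letter of a word acts on entries,
  and inclusion of these sets is the right weak order.\<close>

definition inversions :: "(nat \<Rightarrow> nat) \<Rightarrow> (nat \<times> nat) set" where
  "inversions w = {(a, b). a < b \<and> inv w b < inv w a}"

definition simple_refl :: "nat \<Rightarrow> nat \<Rightarrow> nat" where
  "simple_refl i = Transposition.transpose i (Suc i)"

definition refl_mult :: "nat \<Rightarrow> (nat \<Rightarrow> nat) \<Rightarrow> nat \<Rightarrow> nat" where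
  "refl_mult i w = simple_refl i \<circ> w"

lemma simple_refl_apply:
  "simple_refl i a = (if a = i then Suc i else if a = Suc i then i else a)"
  by (simp add: simple_refl_def Transposition.transpose_def)

lemma simple_refl_simple_refl [simp]: "simple_refl i (simple_refl i a) = a"
  by (simp add: simple_refl_apply)

lemma simple_refl_eq_iff [simp]: "simple_refl i a = simple_refl i b \<longleftrightarrow> a = b"
  by (metis simple_refl_simple_refl)

lemma in_inversions_iff: "(a, b) \<in> inversions w \<longleftrightarrow> a < b \<and> inv w b < inv w a"
  by (simp add: inversions_def)

lemma symmetric_groupD: "w \<in> symmetric_group n \<Longrightarrow> w permutes {1..Suc n}"
  unfolding symmetric_group_def Suc_eq_plus1 by blast

lemma inversions_subset:
  assumes "w \<in> symmetric_group n"
  shows "inversions w \<subseteq> {1..Suc n} \<times> {1..Suc n}"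
proof
  fix x assume "x \<in> inversions w"
  then obtain a b where x: "x = (a, b)" "a < b" "inv w b < inv w a"
    by (auto simp: inversions_def)
  have p: "inv w permutes {1..Suc n}"
    using assms by (intro permutes_inv symmetric_groupD)
  have out: "inv w y = y" if "y \<notin> {1..Suc n}" for y
    using p that by (rule permutes_not_in)
  have into: "inv w y \<in> {1..Suc n}" if "y \<in> {1..Suc n}" for y
    using that permutes_in_image[OF p] by blast
  show "x \<in> {1..Suc n} \<times> {1..Suc n}"
    using x out[of a] out[of b] into[of a] into[of b]
    by (cases "a \<in> {1..Suc n}"; cases "b \<in> {1..Suc n}") auto
qed

lemma finite_inversions: "w \<in> symmetric_group n \<Longrightarrow> finite (inversions w)"
  using inversions_subset finite_subset by blast

lemma inv_refl_mult:
  assumes "w \<in> symmetric_group n"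
  shows "inv (refl_mult i w) = inv w \<circ> simple_refl i"
proof -
  have "bij w" using permutes_bij[OF symmetric_groupD[OF assms]] .
  then show ?thesis by (simp add: o_inv_distrib refl_mult_def simple_refl_def)
qed

lemma refl_mult_in:
  assumes "w \<in> symmetric_group n" "i \<in> {1..n}"
  shows "refl_mult i w \<in> symmetric_group n"
  using assms unfolding symmetric_group_def refl_mult_def simple_refl_def
  by (auto intro!: permutes_compose permutes_swap_id)

lemma refl_mult_refl_mult: "refl_mult i (refl_mult i w) = w"
  by (simp add: refl_mult_def fun_eq_iff)

lemma simple_refl_less:
  assumes "a < b" "(a, b) \<noteq> (i, Suc i)"
  shows "simple_refl i a < simple_refl i b" "(simple_refl i a, simple_refl i b) \<noteq> (i, Suc i)"
  using assms by (auto simp: simple_refl_apply split: if_splits)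

lemma inversions_refl_mult_iff:
  assumes "w \<in> symmetric_group n" "a < b" "(a, b) \<noteq> (i, Suc i)"
  shows "(a, b) \<in> inversions (refl_mult i w) \<longleftrightarrow>
    (simple_refl i a, simple_refl i b) \<in> inversions w"
  using assms(2) simple_refl_less(1)[OF assms(2,3)]
  unfolding in_inversions_iff inv_refl_mult[OF assms(1)] comp_apply by blast

lemma inversions_refl_mult_toggle:
  assumes "w \<in> symmetric_group n"
  shows "(i, Suc i) \<in> inversions (refl_mult i w) \<longleftrightarrow> (i, Suc i) \<notin> inversions w"
proof -
  have "inj (inv w)"
    using permutes_inj[OF permutes_inv[OF symmetric_groupD[OF assms]]] .
  then have "inv w i \<noteq> inv w (Suc i)" by (simp add: inj_eq)
  then show ?thesis
    by (auto simp add: in_inversions_iff inv_refl_mult[OF assms] simple_refl_apply)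
qed

text \<open>Left multiplication by \<open>simple_refl i\<close> exchanges the entries
  \<open>i\<close> and \<open>Suc i\<close>; it preserves the order of every other pair of entries,
  so only the pair \<open>(i, Suc i)\<close> changes status.\<close>

lemma inversions_descent:
  assumes "w \<in> symmetric_group n" "(i, Suc i) \<in> inversions w"
  shows "inversions w =
    insert (i, Suc i) (map_prod (simple_refl i) (simple_refl i) ` inversions (refl_mult i w))"
    (is "_ = insert _ (?f ` ?J)")
proof (intro equalityI subsetI)
  fix x assume x: "x \<in> inversions w"
  obtain a b where ab: "x = (a, b)" by force
  show "x \<in> insert (i, Suc i) (?f ` ?J)"
  proof (cases "x = (i, Suc i)")
    case False
    have "a < b" using x ab by (simp add: in_inversions_iff)
    note l = simple_refl_less[OF this False[unfolded ab]]
    have "(simple_refl i a, simple_refl i b) \<in> ?J"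
      using inversions_refl_mult_iff[OF assms(1) l] x ab by simp
    then have "?f (simple_refl i a, simple_refl i b) \<in> ?f ` ?J" by (rule imageI)
    then show ?thesis using ab by simp
  qed simp
next
  fix x assume x: "x \<in> insert (i, Suc i) (?f ` ?J)"
  show "x \<in> inversions w"
  proof (cases "x = (i, Suc i)")
    case False
    then obtain a b where ab: "x = (simple_refl i a, simple_refl i b)" "(a, b) \<in> ?J"
      using x by (auto simp: map_prod_def)
    have "a < b" using ab by (simp add: in_inversions_iff)
    moreover have "(a, b) \<noteq> (i, Suc i)"
      using ab(2) assms inversions_refl_mult_toggle by metis
    ultimately show ?thesis
      using inversions_refl_mult_iff[OF assms(1)] ab by simp
  qed (use assms in simp)
qed

lemma card_inversions_descent:
  assumes "w \<in> symmetric_group n" "i \<in> {1..n}" "(i, Suc i) \<in> inversions w"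
  shows "card (inversions w) = Suc (card (inversions (refl_mult i w)))"
proof -
  let ?f = "map_prod (simple_refl i) (simple_refl i)"
  let ?J = "inversions (refl_mult i w)"
  have fin: "finite ?J"
    using finite_inversions[OF refl_mult_in[OF assms(1,2)]] .
  have "(i, Suc i) \<notin> ?f ` ?J"
  proof
    assume "(i, Suc i) \<in> ?f ` ?J"
    then obtain a b where "(a, b) \<in> ?J" "simple_refl i a = i" "simple_refl i b = Suc i"
      by auto
    then show False
      by (auto simp: in_inversions_iff simple_refl_apply split: if_splits)
  qed
  moreover have "inj_on ?f ?J"
    by (rule inj_onI) (auto simp: prod_eq_iff)
  ultimately show ?thesis
    using fin by (simp add: inversions_descent[OF assms(1,3)] card_image)
qed

lemma card_inversions_ascent:
  assumes "w \<in> symmetric_group n" "i \<in> {1..n}" "(i, Suc i) \<notin> inversions w"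
  shows "card (inversions (refl_mult i w)) = Suc (card (inversions w))"
  using card_inversions_descent[OF refl_mult_in[OF assms(1,2)] assms(2)]
    inversions_refl_mult_toggle[OF assms(1)] assms(3)
  by (simp add: refl_mult_refl_mult)

lemma id_in_symmetric_group: "id \<in> symmetric_group n"
  by (simp add: symmetric_group_def permutes_id)

lemma inversions_id [simp]: "inversions id = {}"
  and inversions_ident [simp]: "inversions (\<lambda>a. a) = {}"
  by (auto simp: inversions_def simp flip: id_def)

text \<open>Monotonicity gives \<open>i \<le> f i\<close>, so the preimage of \<open>i\<close> is at
  most \<open>i\<close>; it is not smaller, because smaller points are already fixed.\<close>

lemma strict_mono_permutes_eq_id:
  fixes f :: "nat \<Rightarrow> nat"
  assumes "f permutes {1..Suc n}" "\<And>i. i \<in> {1..n} \<Longrightarrow> f i < f (Suc i)"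
  shows "f = id"
proof -
  have ge: "f i \<ge> i" if "i \<in> {1..Suc n}" for i
    using that
  proof (induction i)
    case (Suc i)
    show ?case
    proof (cases "i = 0")
      case True
      then show ?thesis using permutes_in_image[OF assms(1), of 1] by (simp add: One_nat_def)
    next
      case False
      then show ?thesis using Suc assms(2)[of i] by simp
    qed
  qed simp
  have "f i = i" for i
  proof (induction i rule: less_induct)
    case (less i)
    show ?case
    proof (cases "i \<in> {1..Suc n}")
      case True
      obtain j where j: "f j = i" using permutes_surj[OF assms(1)] by (metis surjD)
      then have "j \<in> {1..Suc n}" using True permutes_in_image[OF assms(1), of j] by simp
      then have "j \<le> i" using ge j by auto
      then show ?thesis using less[of j] j by (cases "j = i") auto
    qed (use assms(1) permutes_not_in in metis)
  qed
  then show ?thesis by auto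
qed

lemma descent_exists:
  assumes "w \<in> symmetric_group n" "w \<noteq> id"
  shows "\<exists>i \<in> {1..n}. (i, Suc i) \<in> inversions w"
proof (rule ccontr)
  assume none: "\<not> ?thesis"
  have p: "inv w permutes {1..Suc n}"
    using assms by (intro permutes_inv symmetric_groupD)
  have "inv w i < inv w (Suc i)" if i: "i \<in> {1..n}" for i
  proof -
    have "(i, Suc i) \<notin> inversions w" using none i by blast
    moreover have "inv w i \<noteq> inv w (Suc i)"
      using permutes_inj[OF p] by (simp add: inj_eq)
    ultimately show ?thesis by (auto simp: in_inversions_iff)
  qed
  then have "inv w = id" using strict_mono_permutes_eq_id[OF p] by blast
  moreover have "bij w" using permutes_bij[OF symmetric_groupD[OF assms(1)]] .
  ultimately show False using assms(2) by (metis inv_id inv_inv_eq)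
qed

lemma inversions_empty_iff:
  assumes "w \<in> symmetric_group n"
  shows "inversions w = {} \<longleftrightarrow> w = id"
  using descent_exists[OF assms] by force

section \<open>Length equals the number of inversions\<close>

lemma word_prod_Nil [simp]: "word_prod [] = id"
  and word_prod_Cons [simp]: "word_prod (i # a) = refl_mult i (word_prod a)"
  by (simp_all add: word_prod_def refl_mult_def simple_refl_def One_nat_def)

lemma word_prod_in: "set a \<subseteq> {1..n} \<Longrightarrow> word_prod a \<in> symmetric_group n"
  by (induction a) (auto simp: id_in_symmetric_group intro!: refl_mult_in)

lemma card_inversions_word_prod_le:
  "set a \<subseteq> {1..n} \<Longrightarrow> card (inversions (word_prod a)) \<le> length a"
proof (induction a)
  case (Cons i a)
  then have w: "word_prod a \<in> symmetric_group n" and i: "i \<in> {1..n}"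
    by (auto intro!: word_prod_in)
  then show ?case
    using Cons card_inversions_ascent[OF w i] card_inversions_descent[OF w i]
    by (cases "(i, Suc i) \<in> inversions (word_prod a)") auto
qed simp

lemma word_of_length_card_inversions:
  assumes "w \<in> symmetric_group n"
  shows "\<exists>a. set a \<subseteq> {1..n} \<and> word_prod a = w \<and> length a = card (inversions w)"
  using assms
proof (induction "card (inversions w)" arbitrary: w)
  case 0
  then have "w = id" using inversions_empty_iff[OF 0(2)] finite_inversions[OF 0(2)] by simp
  then show ?case by (intro exI[of _ "[]"]) simp
next
  case (Suc m)
  then have "w \<noteq> id" by auto
  then obtain i where i: "i \<in> {1..n}" "(i, Suc i) \<in> inversions w"
    using descent_exists[OF Suc(3)] by blast
  have c: "card (inversions w) = Suc (card (inversions (refl_mult i w)))"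
    using card_inversions_descent[OF Suc(3) i] .
  obtain a where "set a \<subseteq> {1..n}" "word_prod a = refl_mult i w"
    "length a = card (inversions (refl_mult i w))"
    using Suc(1)[OF _ refl_mult_in[OF Suc(3) i(1)]] Suc(2) c by auto
  then show ?case
    using i c by (intro exI[of _ "i # a"]) (auto simp: refl_mult_refl_mult)
qed

text \<open>A letter changes the number of inversions by exactly one, which gives the lower bound on
  the length; stripping descents attains it.\<close>

lemma reduced_words_iff:
  assumes "w \<in> symmetric_group n"
  shows "a \<in> reduced_words n w \<longleftrightarrow>
    set a \<subseteq> {1..n} \<and> word_prod a = w \<and> length a = card (inversions w)"
proof -
  obtain b where b: "set b \<subseteq> {1..n}" "word_prod b = w" "length b = card (inversions w)"
    using word_of_length_card_inversions[OF assms] by blast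
  have "a \<in> reduced_words n w"
    if "set a \<subseteq> {1..n}" "word_prod a = w" "length a = card (inversions w)"
  proof -
    have "length a \<le> length b" if "b \<in> words_for n w" for b
      using that card_inversions_word_prod_le[of b n] \<open>length a = card (inversions w)\<close>
      by (simp add: words_for_def)
    then show ?thesis using that by (simp add: reduced_words_def words_for_def)
  qed
  moreover have "length a = card (inversions w)" if a: "a \<in> reduced_words n w"
  proof (rule le_antisym)
    show "length a \<le> card (inversions w)"
      using a b by (auto simp: reduced_words_def words_for_def)
    show "card (inversions w) \<le> length a"
      using a card_inversions_word_prod_le by (auto simp: reduced_words_def words_for_def)
  qed
  ultimately show ?thesis
    by (auto simp: reduced_words_def words_for_def)
qed

text \<open>At an ascent the tail of the word would have to spell an element with more inversions
  than the tail has letters.\<close>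

lemma reduced_words_Cons_iff:
  assumes "w \<in> symmetric_group n"
  shows "i # a \<in> reduced_words n w \<longleftrightarrow>
    i \<in> {1..n} \<and> (i, Suc i) \<in> inversions w \<and> a \<in> reduced_words n (refl_mult i w)"
    (is "?L \<longleftrightarrow> ?R")
proof
  assume L: ?L
  then have i: "i \<in> {1..n}" and a: "set a \<subseteq> {1..n}" "refl_mult i (word_prod a) = w"
    "Suc (length a) = card (inversions w)"
    by (auto simp: reduced_words_iff[OF assms])
  have wa: "word_prod a = refl_mult i w"
    using a(2) refl_mult_refl_mult by metis
  have "(i, Suc i) \<in> inversions w"
    using card_inversions_ascent[OF assms i] card_inversions_word_prod_le[OF a(1)] a(3) wa
    by (cases "(i, Suc i) \<in> inversions w") auto
  then show ?R
    using i a wa card_inversions_descent[OF assms i]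
    by (simp add: reduced_words_iff[OF refl_mult_in[OF assms i]])
next
  assume R: ?R
  then have i: "i \<in> {1..n}" by simp
  show ?L
    using R card_inversions_descent[OF assms i]
    by (auto simp: reduced_words_iff[OF refl_mult_in[OF assms i]] reduced_words_iff[OF assms]
        refl_mult_refl_mult)
qed

lemma reduced_words_id: "reduced_words n id = {[]}"
  by (auto simp: reduced_words_iff[OF id_in_symmetric_group])

lemma reduced_words_in_symmetric_group:
  "a \<in> reduced_words n w \<Longrightarrow> w \<in> symmetric_group n"
  by (auto simp: reduced_words_def words_for_def word_prod_in)

lemma reduced_words_nonempty:
  "w \<in> symmetric_group n \<Longrightarrow> \<exists>a. a \<in> reduced_words n w"
  using word_of_length_card_inversions reduced_words_iff by blast

section \<open>The weak order as inclusion of inversion sets\<close>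

lemma inversions_subset_descent_iff:
  assumes u: "u \<in> symmetric_group n" "(i, Suc i) \<in> inversions u"
    and v: "v \<in> symmetric_group n" "(i, Suc i) \<in> inversions v"
  shows "inversions (refl_mult i u) \<subseteq> inversions (refl_mult i v) \<longleftrightarrow>
    inversions u \<subseteq> inversions v" (is "?L \<longleftrightarrow> ?R")
proof
  assume ?L
  then show ?R
    unfolding inversions_descent[OF u] inversions_descent[OF v] by blast
next
  assume R: ?R
  show ?L
  proof
    fix x assume x: "x \<in> inversions (refl_mult i u)"
    obtain a b where ab: "x = (a, b)" by force
    have "a < b" using x ab by (simp add: in_inversions_iff)
    moreover have "(a, b) \<noteq> (i, Suc i)"
      using x ab u inversions_refl_mult_toggle by metis
    ultimately show "x \<in> inversions (refl_mult i v)"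
      using x ab R inversions_refl_mult_iff[OF u(1)] inversions_refl_mult_iff[OF v(1)]
      by blast
  qed
qed

text \<open>A common first letter can be stripped from both sides without affecting the inclusion.
  Conversely, inclusion makes every descent of \<open>u\<close> a descent of \<open>v\<close>, so
  both have reduced words with the same first letter.\<close>

lemma right_weak_le_iff_inversions:
  assumes "u \<in> symmetric_group n" "v \<in> symmetric_group n"
  shows "right_weak_le n u v \<longleftrightarrow> inversions u \<subseteq> inversions v"
proof
  have "inversions u \<subseteq> inversions v"
    if "a \<in> reduced_words n u" "a @ b \<in> reduced_words n v" for a b
    using that assms
  proof (induction a arbitrary: u v)
    case Nil
    then have "u = id" by (simp add: reduced_words_iff)
    then show ?case by simp
  next
    case (Cons i a)
    have u: "i \<in> {1..n}" "(i, Suc i) \<in> inversions u" "a \<in> reduced_words n (refl_mult i u)"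
      and v: "(i, Suc i) \<in> inversions v" "a @ b \<in> reduced_words n (refl_mult i v)"
      using Cons.prems by (simp_all add: reduced_words_Cons_iff)
    show ?case
      using Cons.IH[OF u(3) v(2)] u v Cons.prems
        inversions_subset_descent_iff[of u n i v] refl_mult_in by blast
  qed
  then show "right_weak_le n u v \<Longrightarrow> inversions u \<subseteq> inversions v"
    by (auto simp: right_weak_le_def prefix_def)
next
  assume "inversions u \<subseteq> inversions v"
  with assms show "right_weak_le n u v"
  proof (induction "card (inversions u)" arbitrary: u v)
    case 0
    then have "u = id" using inversions_empty_iff finite_inversions by (metis card_0_eq)
    then show ?case
      using reduced_words_nonempty[OF 0(3)] reduced_words_id[of n] Nil_prefix
      unfolding right_weak_le_def by blast
  next
    case (Suc m)
    then have "u \<noteq> id" by auto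
    then obtain i where i: "i \<in> {1..n}" "(i, Suc i) \<in> inversions u"
      using descent_exists[OF Suc(3)] by blast
    then have iv: "(i, Suc i) \<in> inversions v" using Suc by blast
    have "inversions (refl_mult i u) \<subseteq> inversions (refl_mult i v)"
      using inversions_subset_descent_iff[OF Suc(3) i(2) Suc(4) iv] Suc(5) by blast
    moreover have "m = card (inversions (refl_mult i u))"
      using Suc(2) card_inversions_descent[OF Suc(3) i] by simp
    ultimately have "right_weak_le n (refl_mult i u) (refl_mult i v)"
      using Suc(1) refl_mult_in[OF Suc(3) i(1)] refl_mult_in[OF Suc(4) i(1)] by blast
    then obtain a b where "a \<in> reduced_words n (refl_mult i u)"
      "b \<in> reduced_words n (refl_mult i v)" "prefix a b"
      by (auto simp: right_weak_le_def)
    then have "i # a \<in> reduced_words n u" "i # b \<in> reduced_words n v" "prefix (i # a) (i # b)"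
      using i iv by (simp_all add: reduced_words_Cons_iff[OF Suc(3)] reduced_words_Cons_iff[OF Suc(4)])
    then show ?case unfolding right_weak_le_def by blast
  qed
qed

lemma inversions_inj:
  assumes "u \<in> symmetric_group n" "v \<in> symmetric_group n" "inversions u = inversions v"
  shows "u = v"
  using assms
proof (induction "card (inversions u)" arbitrary: u v)
  case 0
  then show ?case using inversions_empty_iff finite_inversions by (metis card_0_eq)
next
  case (Suc m)
  then have "u \<noteq> id" by auto
  then obtain i where i: "i \<in> {1..n}" "(i, Suc i) \<in> inversions u"
    using descent_exists[OF Suc(3)] by blast
  then have iv: "(i, Suc i) \<in> inversions v" using Suc by blast
  have "inversions (refl_mult i u) = inversions (refl_mult i v)"
    using inversions_subset_descent_iff[OF Suc(3) i(2) Suc(4) iv]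
      inversions_subset_descent_iff[OF Suc(4) iv Suc(3) i(2)] Suc(5) by blast
  moreover have "m = card (inversions (refl_mult i u))"
    using Suc(2) card_inversions_descent[OF Suc(3) i] by simp
  ultimately have "refl_mult i u = refl_mult i v"
    using Suc(1) refl_mult_in[OF Suc(3) i(1)] refl_mult_in[OF Suc(4) i(1)] by blast
  then show ?case using refl_mult_refl_mult by metis
qed

section \<open>Sortable permutations are aligned\<close>

lemma inversions_trans:
  "(a, b) \<in> inversions w \<Longrightarrow> (b, c) \<in> inversions w \<Longrightarrow> (a, c) \<in> inversions w"
  by (auto simp: in_inversions_iff)

text \<open>\<open>A b\<close> means that the entry \<open>b\<close> is lower. If all inner entries
  are lower, the condition says that the one-line notation avoids the pattern 312.\<close>

definition aligned :: "(nat \<Rightarrow> bool) \<Rightarrow> (nat \<times> nat) set \<Rightarrow> bool" where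
  "aligned A I \<longleftrightarrow>
    (\<forall>a b c. a < b \<longrightarrow> b < c \<longrightarrow> (a, c) \<in> I \<longrightarrow> (if A b then (a, b) \<in> I else (b, c) \<in> I))"

text \<open>For the inversion set of a permutation this is membership in the parabolic subgroup
  generated by all letters except \<open>i\<close>.\<close>

definition no_crossing :: "nat \<Rightarrow> (nat \<times> nat) set \<Rightarrow> bool" where
  "no_crossing i I \<longleftrightarrow> (\<forall>a c. (a, c) \<in> I \<longrightarrow> \<not> (a \<le> i \<and> i < c))"

text \<open>The change of labels when the first letter \<open>i\<close> of the Coxeter word moves to
  its end: \<open>i\<close> then comes after both neighbouring letters instead of before them. The
  guards restrict to the entries \<open>2..n\<close>, the only ones that can stand in the middle of
  a triple.\<close>

definition flipped :: "nat \<Rightarrow> nat \<Rightarrow> (nat \<Rightarrow> bool) \<Rightarrow> (nat \<Rightarrow> bool) \<Rightarrow> bool" where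
  "flipped n i A A' \<longleftrightarrow>
    (2 \<le> i \<longrightarrow> \<not> A i \<and> A' i) \<and> (i < n \<longrightarrow> A (Suc i) \<and> \<not> A' (Suc i)) \<and>
    (\<forall>j. 2 \<le> j \<and> j \<le> n \<and> j \<noteq> i \<and> j \<noteq> Suc i \<longrightarrow> A' j = A j)"

lemma inversions_bounds:
  assumes "w \<in> symmetric_group n" "(a, b) \<in> inversions w"
  shows "1 \<le> a" "a < b" "b \<le> Suc n"
proof -
  have "(a, b) \<in> {1..Suc n} \<times> {1..Suc n}" using inversions_subset[OF assms(1)] assms(2) by blast
  then show "1 \<le> a" "a < b" "b \<le> Suc n" using assms(2) by (auto simp: in_inversions_iff)
qed

lemma flipped_simple_refl:
  assumes "flipped n i A A'" "1 \<le> a" "a < b" "b < c" "c \<le> Suc n"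
    and "(a, b) \<noteq> (i, Suc i)" "(b, c) \<noteq> (i, Suc i)"
  shows "A' b \<longleftrightarrow> A (simple_refl i b)" "A b \<longleftrightarrow> A' (simple_refl i b)"
  using assms by (auto simp: flipped_def simple_refl_apply)

text \<open>The reflection carries triples to triples and, by \<open>flipped\<close>, labels to
  labels, unless the middle entry and one neighbour are \<open>i\<close> and \<open>Suc i\<close>.
  In these exceptional triples the forced pair is \<open>(i, Suc i)\<close> itself before the flip,
  and after it the pair follows by transitivity through \<open>(i, Suc i)\<close>.\<close>

lemma aligned_descent_iff:
  assumes w: "w \<in> symmetric_group n" "(i, Suc i) \<in> inversions w" "i \<in> {1..n}"
    and fl: "flipped n i A A'"
  shows "aligned A (inversions w) \<longleftrightarrow> aligned A' (inversions (refl_mult i w))"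
    (is "aligned A ?I \<longleftrightarrow> aligned A' ?I'")
proof
  let ?s = "simple_refl i"
  note tr = inversions_refl_mult_iff[OF w(1)]
  note w' = refl_mult_in[OF w(1,3)]
  assume al: "aligned A ?I"
  show "aligned A' ?I'"
    unfolding aligned_def
  proof (intro allI impI)
    fix a b c assume abc: "a < b" "b < c" and ac: "(a, c) \<in> ?I'"
    have bd: "1 \<le> a" "c \<le> Suc n" using inversions_bounds[OF w' ac] by auto
    have acI: "(?s a, ?s c) \<in> ?I" using tr[of a c i] ac abc by auto
    consider (1) "(a, b) = (i, Suc i)" | (2) "(b, c) = (i, Suc i)"
      | (3) "(a, b) \<noteq> (i, Suc i)" "(b, c) \<noteq> (i, Suc i)" by blast
    then show "if A' b then (a, b) \<in> ?I' else (b, c) \<in> ?I'"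
    proof cases
      case 1
      then have "(Suc i, c) \<in> ?I" using acI abc by (simp add: simple_refl_apply)
      then have "(i, c) \<in> ?I" using w(2) inversions_trans by blast
      then have "(b, c) \<in> ?I'" using tr[of b c i] 1 abc by (simp add: simple_refl_apply)
      moreover have "\<not> A' b" using 1 fl abc bd by (auto simp: flipped_def)
      ultimately show ?thesis by simp
    next
      case 2
      then have "(a, i) \<in> ?I" using acI abc by (simp add: simple_refl_apply)
      then have "(a, Suc i) \<in> ?I" using w(2) inversions_trans by blast
      then have "(a, b) \<in> ?I'" using tr[of a b i] 2 abc by (simp add: simple_refl_apply)
      moreover have "A' b" using 2 fl abc bd by (auto simp: flipped_def)
      ultimately show ?thesis by simp
    next
      case 3
      note l = simple_refl_less[OF abc(1) 3(1)] simple_refl_less[OF abc(2) 3(2)]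
      have "if A (?s b) then (?s a, ?s b) \<in> ?I else (?s b, ?s c) \<in> ?I"
        using al acI l unfolding aligned_def by blast
      then show ?thesis
        using flipped_simple_refl[OF fl bd(1) abc bd(2) 3] tr[OF abc(1) 3(1)] tr[OF abc(2) 3(2)]
        by presburger
    qed
  qed
next
  let ?s = "simple_refl i"
  note tr = inversions_refl_mult_iff[OF w(1)]
  assume al: "aligned A' ?I'"
  show "aligned A ?I"
    unfolding aligned_def
  proof (intro allI impI)
    fix a b c assume abc: "a < b" "b < c" and ac: "(a, c) \<in> ?I"
    have bd: "1 \<le> a" "c \<le> Suc n" using inversions_bounds[OF w(1) ac] by auto
    consider (1) "(a, b) = (i, Suc i)" | (2) "(b, c) = (i, Suc i)"
      | (3) "(a, b) \<noteq> (i, Suc i)" "(b, c) \<noteq> (i, Suc i)" by blast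
    then show "if A b then (a, b) \<in> ?I else (b, c) \<in> ?I"
    proof cases
      case 1
      then have "A b" using fl abc bd by (auto simp: flipped_def)
      then show ?thesis using w(2) 1 by simp
    next
      case 2
      then have "\<not> A b" using fl abc bd by (auto simp: flipped_def)
      then show ?thesis using w(2) 2 by simp
    next
      case 3
      have l1: "?s a < ?s b" "(?s a, ?s b) \<noteq> (i, Suc i)" and l2: "?s b < ?s c" "(?s b, ?s c) \<noteq> (i, Suc i)"
        using simple_refl_less[OF abc(1) 3(1)] simple_refl_less[OF abc(2) 3(2)] by auto
      have "?s a < ?s c" "(?s a, ?s c) \<noteq> (i, Suc i)" using l1 l2 by auto
      then have "(?s a, ?s c) \<in> ?I'" using tr[of "?s a" "?s c" i] ac by simp
      then have "if A' (?s b) then (?s a, ?s b) \<in> ?I' else (?s b, ?s c) \<in> ?I'"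
        using al l1 l2 unfolding aligned_def by blast
      then show ?thesis
        using flipped_simple_refl[OF fl bd(1) abc bd(2) 3] tr[OF l1] tr[OF l2]
        by (simp split: if_splits)
    qed
  qed
qed

text \<open>A crossing inversion would force, at the upper entry \<open>i\<close> and then at the
  lower entry \<open>Suc i\<close>, the absent inversion \<open>(i, Suc i)\<close>. Without
  crossings neither entry is ever in the middle of a triple with inverted ends, and the other labels
  agree.\<close>

lemma aligned_ascent_iff:
  assumes w: "w \<in> symmetric_group n" "(i, Suc i) \<notin> inversions w" "i \<in> {1..n}"
    and fl: "flipped n i A A'"
  shows "aligned A (inversions w) \<longleftrightarrow>
    no_crossing i (inversions w) \<and> aligned A' (inversions w)" (is "?L \<longleftrightarrow> ?C \<and> ?R")
proof -
  have same: "A b = A' b" if "no_crossing i (inversions w)" "(a, c) \<in> inversions w" "a < b" "b < c"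
    for a b c
  proof -
    have "b \<noteq> i" "b \<noteq> Suc i" using that unfolding no_crossing_def by fastforce+
    then show ?thesis
      using fl that inversions_bounds[OF w(1) that(2)] by (simp add: flipped_def)
  qed
  have "?C" if al: ?L
  proof -
    have right: "(i, c) \<notin> inversions w" for c
    proof
      assume ic: "(i, c) \<in> inversions w"
      then have "Suc i < c" using w(2) inversions_bounds[OF w(1) ic] by (cases "c = Suc i") auto
      moreover from this have "A (Suc i)"
        using fl inversions_bounds[OF w(1) ic] by (auto simp: flipped_def)
      ultimately show False using al ic w(2) unfolding aligned_def by (metis lessI)
    qed
    show ?C
      unfolding no_crossing_def
    proof (intro allI impI notI)
      fix a c assume ac: "(a, c) \<in> inversions w" and "a \<le> i \<and> i < c"
      then have "a < i" "i < c" using right by (cases "a = i", auto)+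
      moreover from this have "\<not> A i"
        using fl inversions_bounds[OF w(1) ac] by (auto simp: flipped_def)
      ultimately show False using al ac right unfolding aligned_def by metis
    qed
  qed
  moreover have "?L \<longleftrightarrow> ?R" if ?C
    unfolding aligned_def using same[OF that] by metis
  ultimately show ?thesis by blast
qed

lemma no_crossing_descent_iff:
  assumes w: "w \<in> symmetric_group n" "(j, Suc j) \<in> inversions w" and "j \<noteq> i"
  shows "no_crossing i (inversions w) \<longleftrightarrow> no_crossing i (inversions (refl_mult j w))"
proof -
  have s: "simple_refl j a \<le> i \<longleftrightarrow> a \<le> i" for a
    using \<open>j \<noteq> i\<close> by (auto simp: simple_refl_apply)
  have s': "i < simple_refl j a \<longleftrightarrow> i < a" for a
    using s[of a] by linarith
  have ji: "\<not> (j \<le> i \<and> i < Suc j)" using \<open>j \<noteq> i\<close> by auto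
  have "no_crossing i I \<longleftrightarrow> (\<forall>x\<in>I. \<not> (fst x \<le> i \<and> i < snd x))" for I
    by (auto simp: no_crossing_def)
  then show ?thesis
    unfolding inversions_descent[OF w] using ji s s' by simp
qed

lemma all_ge_iff: "(\<forall>m\<ge>k. P m) \<longleftrightarrow> P k \<and> (\<forall>m\<ge>Suc k. P m)" for k :: nat
  by (metis Suc_leD Suc_le_eq le_less order_refl)

lemma reduced_word_avoids_iff:
  "a \<in> reduced_words n w \<Longrightarrow> i \<notin> set a \<longleftrightarrow> no_crossing i (inversions w)"
proof (induction a arbitrary: w)
  case Nil
  then have "w = id" by (auto simp: reduced_words_def words_for_def)
  then show ?case by (simp add: no_crossing_def)
next
  case (Cons j a)
  have w: "w \<in> symmetric_group n" using Cons.prems reduced_words_in_symmetric_group by blast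
  have j: "(j, Suc j) \<in> inversions w" "a \<in> reduced_words n (refl_mult j w)"
    using Cons.prems by (simp_all add: reduced_words_Cons_iff[OF w])
  show ?case
  proof (cases "j = i")
    case True
    then show ?thesis using j(1) unfolding no_crossing_def by auto
  next
    case False
    then show ?thesis
      using Cons.IH[OF j(2)] no_crossing_descent_iff[OF w j(1) False] by simp
  qed
qed

section \<open>Scanning the repeated Coxeter word\<close>

locale coxeter_word =
  fixes n :: nat and cs :: "nat list"
  assumes n_pos: "1 \<le> n" and distinct_cs: "distinct cs" and set_cs: "set cs = {1..n}"
begin

lemma length_cs: "length cs = n"
  using distinct_card[OF distinct_cs] set_cs by simp

lemma letter_at_in: "letter_at cs k \<in> {1..n}"
  using n_pos length_cs set_cs nth_mem[of "k mod length cs" cs] by (simp add: letter_at_def)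

lemma letter_at_eq_iff: "letter_at cs k = letter_at cs l \<longleftrightarrow> k mod n = l mod n"
  using n_pos length_cs distinct_cs by (simp add: letter_at_def nth_eq_iff_index_eq)

lemma letter_at_add [simp]: "letter_at cs (k + n) = letter_at cs k"
  by (simp add: letter_at_eq_iff)

definition next_occ :: "nat \<Rightarrow> nat \<Rightarrow> nat" where
  "next_occ k i = (LEAST m. k \<le> m \<and> letter_at cs m = i)"

lemma next_occ:
  assumes "i \<in> {1..n}"
  shows "k \<le> next_occ k i" "letter_at cs (next_occ k i) = i" "next_occ k i < k + n"
proof -
  obtain q where q: "q < n" "cs ! q = i"
    using assms set_cs length_cs by (metis in_set_conv_nth)
  then have "letter_at cs (k * n + q) = i" by (simp add: letter_at_def length_cs)
  moreover have "k \<le> k * n + q" using n_pos by (simp add: trans_le_add1)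
  ultimately have "\<exists>m. k \<le> m \<and> letter_at cs m = i" by blast
  then have m: "k \<le> next_occ k i \<and> letter_at cs (next_occ k i) = i"
    unfolding next_occ_def by (rule LeastI_ex)
  then show "k \<le> next_occ k i" "letter_at cs (next_occ k i) = i" by auto
  show "next_occ k i < k + n"
  proof (rule ccontr)
    assume c: "\<not> next_occ k i < k + n"
    define m' where "m' = next_occ k i - n"
    have "next_occ k i = m' + n" using c by (simp add: m'_def)
    then have "k \<le> m' \<and> letter_at cs m' = i"
      using m c by (metis letter_at_add add_le_cancel_right not_less)
    then have "next_occ k i \<le> m'" unfolding next_occ_def by (rule Least_le)
    then show False using \<open>next_occ k i = m' + n\<close> n_pos by simp
  qed
qed

lemma next_occ_unique:
  assumes "k \<le> m" "m < k + n" "letter_at cs m = i"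
  shows "next_occ k i = m"
proof -
  have i: "i \<in> {1..n}" using assms(3) letter_at_in by blast
  note o = next_occ[OF i, of k]
  have "next_occ k i mod n = m mod n" using o(2) assms(3) letter_at_eq_iff by metis
  then show ?thesis
  proof (cases "next_occ k i" m rule: linorder_cases)
    case less
    then have "n dvd m - next_occ k i"
      using \<open>next_occ k i mod n = m mod n\<close> mod_eq_dvd_iff_nat[of "next_occ k i" m n] by simp
    then show ?thesis using less o assms dvd_imp_le[of n "m - next_occ k i"] by linarith
  next
    case greater
    then have "n dvd next_occ k i - m"
      using \<open>next_occ k i mod n = m mod n\<close> mod_eq_dvd_iff_nat[of m "next_occ k i" n] by simp
    then show ?thesis using greater o assms dvd_imp_le[of n "next_occ k i - m"] by linarith
  qed
qed

text \<open>The labels of the rotated word that starts at position \<open>k\<close>;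
  \<open>k = 0\<close> gives those of the Coxeter word itself.\<close>

definition lower_at :: "nat \<Rightarrow> nat \<Rightarrow> bool" where
  "lower_at k j \<longleftrightarrow> next_occ k (j - 1) < next_occ k j"

text \<open>Passing position \<open>k\<close> moves only the next occurrence of its own letter, from
  \<open>k\<close>, before all others, to \<open>k + n\<close>, after all others.\<close>

lemma flipped_lower_at: "flipped n (letter_at cs k) (lower_at k) (lower_at (Suc k))"
proof -
  define i where "i = letter_at cs k"
  have i: "i \<in> {1..n}" using letter_at_in by (simp add: i_def)
  have ki: "next_occ k i = k" using n_pos by (intro next_occ_unique) (simp_all add: i_def)
  have Ski: "next_occ (Suc k) i = k + n" using n_pos by (intro next_occ_unique) (simp_all add: i_def)
  have other: "next_occ (Suc k) j = next_occ k j \<and> k < next_occ k j \<and> next_occ k j < k + n"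
    if "j \<in> {1..n}" "j \<noteq> i" for j
  proof -
    have "next_occ k j \<noteq> k" using next_occ(2)[OF that(1), of k] that(2) by (auto simp: i_def)
    then have "k < next_occ k j" using next_occ(1)[OF that(1), of k] by simp
    then show ?thesis
      using next_occ[OF that(1), of k] by (intro conjI next_occ_unique) auto
  qed
  have in_pred: "2 \<le> j \<Longrightarrow> j \<le> n \<Longrightarrow> j - 1 \<in> {1..n}" for j by auto
  have a: "\<not> lower_at k i \<and> lower_at (Suc k) i" if "2 \<le> i"
  proof -
    have "i - 1 \<noteq> i" using that by simp
    then show ?thesis
      using other[OF in_pred[OF that]] i ki Ski by (simp add: lower_at_def)
  qed
  have b: "lower_at k (Suc i) \<and> \<not> lower_at (Suc k) (Suc i)" if "i < n"
    using other[of "Suc i"] that i ki Ski by (auto simp: lower_at_def)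
  have c: "lower_at (Suc k) j = lower_at k j" if "2 \<le> j" "j \<le> n" "j \<noteq> i" "j \<noteq> Suc i" for j
  proof -
    have "j - 1 \<noteq> i" using that by auto
    then show ?thesis
      using other[OF in_pred[OF that(1,2)]] other[of j] that by (simp add: lower_at_def)
  qed
  show ?thesis unfolding flipped_def i_def[symmetric] using a b c by blast
qed

text \<open>The start \<open>k\<close> is a parameter so that the sorting word, the case
  \<open>k = 0\<close>, can be built by a scan.\<close>

definition subwords_from :: "nat \<Rightarrow> (nat \<Rightarrow> nat) \<Rightarrow> nat list set" where
  "subwords_from k w = {ks. sorted_wrt (<) ks \<and> (\<forall>m \<in> set ks. k \<le> m) \<and>
    map (letter_at cs) ks \<in> reduced_words n w}"

definition first_subword :: "nat \<Rightarrow> (nat \<Rightarrow> nat) \<Rightarrow> nat list \<Rightarrow> bool" where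
  "first_subword k w ks \<longleftrightarrow> ks \<in> subwords_from k w \<and>
    (\<forall>ls \<in> subwords_from k w. ls = ks \<or> (ks, ls) \<in> lexord less_than)"

lemma is_sorting_word_iff: "is_sorting_word n cs w ks \<longleftrightarrow> first_subword 0 w ks"
  by (simp add: is_sorting_word_def first_subword_def subwords_from_def reduced_subwords_def)

lemma subwords_from_id: "subwords_from k id = {[]}"
  unfolding subwords_from_def reduced_words_id by auto

lemma subwords_from_ascent:
  assumes "w \<in> symmetric_group n" "(letter_at cs k, Suc (letter_at cs k)) \<notin> inversions w"
  shows "subwords_from k w = subwords_from (Suc k) w"
proof (intro equalityI subsetI)
  fix ks assume ks: "ks \<in> subwords_from k w"
  show "ks \<in> subwords_from (Suc k) w"
  proof (cases ks)
    case (Cons m ls)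
    then have "m \<noteq> k"
      using ks assms(2) by (auto simp: subwords_from_def reduced_words_Cons_iff[OF assms(1)])
    then have "k < m" "\<forall>x \<in> set ls. m < x" using ks Cons by (auto simp: subwords_from_def)
    then show ?thesis using ks Cons by (auto simp: subwords_from_def)
  qed (use ks in \<open>auto simp: subwords_from_def\<close>)
qed (auto simp: subwords_from_def)

lemma subwords_from_Cons_iff:
  assumes w: "w \<in> symmetric_group n" "(letter_at cs k, Suc (letter_at cs k)) \<in> inversions w"
  shows "k # ks \<in> subwords_from k w \<longleftrightarrow> ks \<in> subwords_from (Suc k) (refl_mult (letter_at cs k) w)"
  using w letter_at_in[of k]
  by (auto simp: subwords_from_def reduced_words_Cons_iff[OF w(1)] Suc_le_eq intro: less_imp_le)

lemma subwords_from_nonempty_list: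
  assumes "w \<in> symmetric_group n" "(a, b) \<in> inversions w" "ks \<in> subwords_from k w"
  shows "\<exists>m ls. ks = m # ls \<and> k \<le> m"
  using assms by (cases ks) (auto simp: subwords_from_def reduced_words_iff[OF assms(1)])

text \<open>The greedy choice: a subword that skips position \<open>k\<close> has a larger first
  position, so it is lexicographically later whatever follows.\<close>

lemma first_subword_Cons:
  assumes w: "w \<in> symmetric_group n" "(letter_at cs k, Suc (letter_at cs k)) \<in> inversions w"
    and ks: "first_subword (Suc k) (refl_mult (letter_at cs k) w) ks"
  shows "first_subword k w (k # ks)"
  unfolding first_subword_def
proof (intro conjI ballI)
  show "k # ks \<in> subwords_from k w"
    using ks subwords_from_Cons_iff[OF w] by (simp add: first_subword_def)
  fix ls assume ls: "ls \<in> subwords_from k w"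
  then obtain m ls' where m: "ls = m # ls'" "k \<le> m"
    using subwords_from_nonempty_list[OF w] by blast
  show "ls = k # ks \<or> (k # ks, ls) \<in> lexord less_than"
  proof (cases "m = k")
    case True
    then have "ls' \<in> subwords_from (Suc k) (refl_mult (letter_at cs k) w)"
      using ls m subwords_from_Cons_iff[OF w] by simp
    then show ?thesis using ks m True by (auto simp: first_subword_def)
  qed (use m in auto)
qed

lemma first_subword_unique:
  assumes "first_subword k w ks" "first_subword k w ls"
  shows "ks = ls"
proof (rule ccontr)
  assume "ks \<noteq> ls"
  then have "(ks, ls) \<in> lexord less_than" "(ls, ks) \<in> lexord less_than"
    using assms by (auto simp: first_subword_def)
  moreover have "asym (lexord less_than)"
    by (intro lexord_asym) (auto intro: asymI)
  ultimately show False by (auto dest: asymD)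
qed

text \<open>Ascents do not lower the number of inversions. But a descent letter of \<open>w\<close>
  occurs within the next \<open>n\<close> positions; there the induction hypothesis applies, and the
  claim is pulled back from it to \<open>k\<close> one position at a time.\<close>

lemma scan_induct [consumes 1, case_names id descent ascent]:
  assumes "w \<in> symmetric_group n"
    and "\<And>k. P k id"
    and desc: "\<And>k w. w \<in> symmetric_group n \<Longrightarrow>
      (letter_at cs k, Suc (letter_at cs k)) \<in> inversions w \<Longrightarrow>
      P (Suc k) (refl_mult (letter_at cs k) w) \<Longrightarrow> P k w"
    and asc: "\<And>k w. w \<in> symmetric_group n \<Longrightarrow>
      (letter_at cs k, Suc (letter_at cs k)) \<notin> inversions w \<Longrightarrow> P (Suc k) w \<Longrightarrow> P k w"
  shows "P k w"
  using assms(1)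
proof (induction "card (inversions w)" arbitrary: k w rule: less_induct)
  case less
  have IH: "P l w"
    if d: "(letter_at cs l, Suc (letter_at cs l)) \<in> inversions w" for l
  proof (rule desc[OF less(2) d])
    show "P (Suc l) (refl_mult (letter_at cs l) w)"
      using card_inversions_descent[OF less(2) letter_at_in d]
      by (intro less(1) refl_mult_in less(2) letter_at_in) simp
  qed
  show ?case
  proof (cases "w = id")
    case False
    then obtain i where i: "i \<in> {1..n}" "(i, Suc i) \<in> inversions w"
      using descent_exists[OF less(2)] by blast
    have "k \<le> next_occ k i" using next_occ(1)[OF i(1)] .
    then show ?thesis
    proof (induction rule: inc_induct)
      case base
      show ?case using IH i next_occ(2)[OF i(1)] by simp
    next
      case (step m)
      show ?case using IH[of m] asc[OF less(2) _ step(3)] by blast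
    qed
  qed (use assms(2) in simp)
qed

lemma first_subword_exists:
  assumes "w \<in> symmetric_group n"
  shows "\<exists>ks. first_subword k w ks"
  using assms
proof (induction k w rule: scan_induct)
  case (id k)
  then show ?case
    unfolding first_subword_def subwords_from_id by simp
next
  case (descent k w)
  then show ?case using first_subword_Cons by blast
next
  case (ascent k w)
  then show ?case using subwords_from_ascent[OF ascent(1,2)] by (simp add: first_subword_def)
qed

text \<open>Consecutive copies of the word differ by a shift of \<open>n\<close>, so for
  \<open>k = 0\<close> this is the decreasing chain of blocks. Positions before \<open>k\<close> are
  dropped because the scan has left them behind.\<close>

definition nested :: "nat \<Rightarrow> nat list \<Rightarrow> bool" where
  "nested k ks \<longleftrightarrow> (\<forall>m\<ge>k. m + n \<in> set ks \<longrightarrow> m \<in> set ks)"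

text \<open>Both sides obey the same recursion: at a descent the letter is taken and the word
  rotates; at an ascent the letter must never be used, so the permutation lies in the parabolic
  subgroup without it.\<close>

lemma nested_iff_aligned:
  assumes "w \<in> symmetric_group n" "first_subword k w ks"
  shows "nested k ks \<longleftrightarrow> aligned (lower_at k) (inversions w)"
  using assms
proof (induction k w arbitrary: ks rule: scan_induct)
  case (id k)
  then have "ks = []"
    unfolding first_subword_def subwords_from_id by simp
  then show ?case by (simp add: nested_def aligned_def)
next
  case (descent k w)
  obtain ks' where ks': "first_subword (Suc k) (refl_mult (letter_at cs k) w) ks'"
    using first_subword_exists refl_mult_in[OF descent(1) letter_at_in] by blast
  have ks: "ks = k # ks'"
    using first_subword_unique[OF descent(4) first_subword_Cons[OF descent(1,2) ks']] .
  have "nested k ks \<longleftrightarrow> nested (Suc k) ks'"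
    using n_pos unfolding ks nested_def all_ge_iff[of k] by auto
  also have "\<dots> \<longleftrightarrow> aligned (lower_at (Suc k)) (inversions (refl_mult (letter_at cs k) w))"
    using descent(3)[OF ks'] .
  also have "\<dots> \<longleftrightarrow> aligned (lower_at k) (inversions w)"
    using aligned_descent_iff[OF descent(1,2) letter_at_in flipped_lower_at] by simp
  finally show ?case .
next
  case (ascent k w)
  let ?i = "letter_at cs k"
  have ks: "first_subword (Suc k) w ks"
    using ascent(4) subwords_from_ascent[OF ascent(1,2)] by (simp add: first_subword_def)
  then have ge: "Suc k \<le> m" if "m \<in> set ks" for m
    using that by (auto simp: first_subword_def subwords_from_def)
  have rw: "map (letter_at cs) ks \<in> reduced_words n w"
    using ks by (simp add: first_subword_def subwords_from_def)
  have "nested k ks \<longleftrightarrow> k + n \<notin> set ks \<and> nested (Suc k) ks"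
    using ge[of k] unfolding nested_def all_ge_iff[of k] by auto
  also have "\<dots> \<longleftrightarrow> no_crossing ?i (inversions w) \<and> nested (Suc k) ks"
  proof -
    have "?i \<notin> set (map (letter_at cs) ks)" if out: "k + n \<notin> set ks" and ne: "nested (Suc k) ks"
    proof
      assume "?i \<in> set (map (letter_at cs) ks)"
      then obtain m where m: "m \<in> set ks" "letter_at cs m = ?i" by auto
      \<comment> \<open>Nesting leads from an occurrence at \<open>m\<close> to occurrences at
        \<open>m - n\<close>, \<open>m - 2 * n\<close> and so on, down to the excluded position
        \<open>k + n\<close>.\<close>
      have "m \<notin> set ks" if "letter_at cs m = ?i" for m
        using that
      proof (induction m rule: less_induct)
        case (less m)
        show ?case
        proof
          assume mk: "m \<in> set ks"
          have "k < m" using ge[OF mk] by simp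
          have "n dvd m - k"
            using less(2) \<open>k < m\<close> mod_eq_dvd_iff_nat[of k m n] by (simp add: letter_at_eq_iff)
          then have "n \<le> m - k" using \<open>k < m\<close> by (simp add: dvd_imp_le)
          then have m': "m = (m - n) + n" by simp
          have "m \<noteq> k + n" using out mk by blast
          then have "Suc k \<le> m - n" using \<open>n \<le> m - k\<close> \<open>k < m\<close> by linarith
          then have "m - n \<in> set ks" using ne mk m' unfolding nested_def by metis
          moreover have "letter_at cs (m - n) = letter_at cs k"
            using less(2) letter_at_add[of "m - n"] m' by simp
          then have "m - n \<notin> set ks"
            using less(1)[of "m - n"] n_pos \<open>k < m\<close> by simp
          ultimately show False by simp
        qed
      qed
      then show False using m by blast
    qed
    moreover have "k + n \<notin> set ks" if "?i \<notin> set (map (letter_at cs) ks)"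
      using that letter_at_add by (metis image_eqI list.set_map)
    ultimately show ?thesis using reduced_word_avoids_iff[OF rw, of ?i] by blast
  qed
  also have "\<dots> \<longleftrightarrow> aligned (lower_at k) (inversions w)"
    using ascent(3)[OF ks] aligned_ascent_iff[OF ascent(1,2) letter_at_in flipped_lower_at] by simp
  finally show ?case .
qed

lemma block_letters_subset_iff:
  "block_letters cs ks (Suc i) \<subseteq> block_letters cs ks i \<longleftrightarrow>
    (\<forall>m. m div n = i \<longrightarrow> m + n \<in> set ks \<longrightarrow> m \<in> set ks)"
proof
  assume sub: "block_letters cs ks (Suc i) \<subseteq> block_letters cs ks i"
  show "\<forall>m. m div n = i \<longrightarrow> m + n \<in> set ks \<longrightarrow> m \<in> set ks"
  proof (intro allI impI)
    fix m assume m: "m div n = i" "m + n \<in> set ks"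
    have "letter_at cs (m + n) \<in> block_letters cs ks (Suc i)"
      unfolding block_letters_def using m n_pos by (intro imageI) (simp add: length_cs)
    then obtain l where l: "l \<in> set ks" "l div n = i" "letter_at cs l = letter_at cs m"
      using sub by (auto simp: block_letters_def length_cs)
    then have "l mod n = m mod n" by (simp add: letter_at_eq_iff)
    then have "l = m" using l m div_mult_mod_eq[of l n] div_mult_mod_eq[of m n] by simp
    then show "m \<in> set ks" using l by simp
  qed
next
  assume all: "\<forall>m. m div n = i \<longrightarrow> m + n \<in> set ks \<longrightarrow> m \<in> set ks"
  show "block_letters cs ks (Suc i) \<subseteq> block_letters cs ks i"
  proof
    fix x assume "x \<in> block_letters cs ks (Suc i)"
    then obtain l where l: "l \<in> set ks" "l div n = Suc i" "x = letter_at cs l"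
      by (auto simp: block_letters_def length_cs)
    have "n \<le> l" using l(2) by (metis Zero_not_Suc div_less not_less)
    then have lm: "l = (l - n) + n" by simp
    then have "(l - n) div n = i"
      using l(2) n_pos by (metis diff_Suc_1 div_add_self2 not_one_le_zero Suc_eq_plus1 add_diff_cancel_right')
    then show "x \<in> block_letters cs ks i"
      using all lm l letter_at_add unfolding block_letters_def length_cs
      by (metis (mono_tags, lifting) image_eqI mem_Collect_eq)
  qed
qed

lemma sortable_iff_aligned:
  "sortable n cs w \<longleftrightarrow> w \<in> symmetric_group n \<and> aligned (lower_at 0) (inversions w)"
proof (cases "w \<in> symmetric_group n")
  case True
  obtain ks where ks: "first_subword 0 w ks" using first_subword_exists[OF True] by blast
  have "sortable n cs w \<longleftrightarrow>
      (\<forall>i. block_letters cs ks (Suc i) \<subseteq> block_letters cs ks i)"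
    using True ks first_subword_unique unfolding sortable_def is_sorting_word_iff by blast
  also have "\<dots> \<longleftrightarrow> nested 0 ks"
    unfolding block_letters_subset_iff nested_def by auto
  finally show ?thesis using nested_iff_aligned[OF True ks] True by simp
qed (simp add: sortable_def)

end

section \<open>Ungarian chains on families of sets\<close>

definition coin_pmf :: "real \<Rightarrow> (nat \<times> 'a) set \<Rightarrow> (nat \<times> 'a \<Rightarrow> bool) pmf" where
  "coin_pmf p K = Pi_pmf K False (\<lambda>_. bernoulli_pmf p)"

text \<open>The coin space is an infinite product. A quantity that sees only the coins in a finite
  \<open>K\<close> factors through \<open>mask K\<close>, and resetting the other coins to
  \<open>False\<close> matches the default value of \<open>coin_pmf\<close>.\<close>

definition mask :: "'i set \<Rightarrow> ('i \<Rightarrow> bool) \<Rightarrow> 'i \<Rightarrow> bool" where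
  "mask K \<omega> = (\<lambda>k. k \<in> K \<and> \<omega> k)"

lemma space_coin_space: "space (coin_space p) = UNIV"
  by (auto simp: coin_space_def space_PiM)

lemma mask_preimage:
  "mask K -` {f} = (if \<forall>k. k \<notin> K \<longrightarrow> \<not> f k then {\<omega>. \<forall>k\<in>K. \<omega> k \<in> {f k}} else {})"
  by (simp add: set_eq_iff mask_def fun_eq_iff) blast

lemma coin_cylinder:
  assumes "finite K"
  shows "{\<omega>. \<forall>k\<in>K. \<omega> k \<in> {f k}} \<in> sets (coin_space p)"
    and "emeasure (coin_space p) {\<omega>. \<forall>k\<in>K. \<omega> k \<in> {f k}} = (\<Prod>k\<in>K. pmf (bernoulli_pmf p) (f k))"
proof -
  interpret P: product_prob_space "\<lambda>_. measure_pmf (bernoulli_pmf p)" UNIV ..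
  have sp: "space (\<Pi>\<^sub>M ty \<in> UNIV. measure_pmf (bernoulli_pmf p)) = UNIV"
    by (auto simp: space_PiM)
  have "{\<omega>. \<forall>k\<in>K. \<omega> k \<in> {f k}} =
      {\<omega> \<in> space (\<Pi>\<^sub>M ty \<in> UNIV. measure_pmf (bernoulli_pmf p)). \<forall>k\<in>K. \<omega> k \<in> {f k}}"
    by (simp add: sp)
  moreover have "emeasure (\<Pi>\<^sub>M ty \<in> UNIV. measure_pmf (bernoulli_pmf p)) \<dots> =
      (\<Prod>k\<in>K. emeasure (measure_pmf (bernoulli_pmf p)) {f k})"
    using assms by (intro P.emeasure_PiM_Collect) auto
  ultimately show "emeasure (coin_space p) {\<omega>. \<forall>k\<in>K. \<omega> k \<in> {f k}} =
      (\<Prod>k\<in>K. pmf (bernoulli_pmf p) (f k))"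
    by (simp add: coin_space_def emeasure_pmf_single prod_ennreal)
  have "{\<omega> \<in> space (\<Pi>\<^sub>M ty \<in> UNIV. measure_pmf (bernoulli_pmf p)). \<forall>k\<in>K. \<omega> k \<in> {f k}} \<in>
      sets (\<Pi>\<^sub>M ty \<in> UNIV. measure_pmf (bernoulli_pmf p))"
    using assms by (intro sets.sets_Collect_finite_All sets_Collect_single') auto
  then show "{\<omega>. \<forall>k\<in>K. \<omega> k \<in> {f k}} \<in> sets (coin_space p)"
    by (simp add: coin_space_def sp)
qed

lemma finite_range_mask:
  assumes "finite K"
  shows "finite (range (mask K))"
proof (rule finite_subset)
  show "range (mask K) \<subseteq> PiE_dflt K False (\<lambda>_. UNIV)"
    by (auto simp: mask_def PiE_dflt_def)
qed (use assms in auto)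

lemma mask_measurable:
  assumes "finite K"
  shows "mask K \<in> measurable (coin_space p) (count_space UNIV)"
proof (rule measurableI)
  fix A :: "(nat \<times> 'a \<Rightarrow> bool) set"
  have "mask K -` A = (\<Union>f \<in> A \<inter> range (mask K). mask K -` {f})" by auto
  also have "\<dots> \<in> sets (coin_space p)"
  proof (rule sets.finite_UN)
    show "finite (A \<inter> range (mask K))" using finite_range_mask[OF assms] by simp
    show "mask K -` {f} \<in> sets (coin_space p)" for f
      using coin_cylinder(1)[OF assms] unfolding mask_preimage by simp
  qed
  finally show "mask K -` A \<inter> space (coin_space p) \<in> sets (coin_space p)"
    by (simp add: space_coin_space)
qed simp

lemma distr_mask:
  assumes "finite K"
  shows "distr (coin_space p) (count_space UNIV) (mask K) = measure_pmf (coin_pmf p K)"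
proof (rule measure_eqI_countable_AE)
  let ?Om = "PiE_dflt K False (\<lambda>_. UNIV)"
  show "AE x in distr (coin_space p) (count_space UNIV) (mask K). x \<in> ?Om"
    using mask_measurable[OF assms]
    by (subst AE_distr_iff) (auto simp: mask_def PiE_dflt_def)
  show "AE x in measure_pmf (coin_pmf p K). x \<in> ?Om"
    unfolding AE_measure_pmf_iff
  proof
    fix y assume "y \<in> set_pmf (coin_pmf p K)"
    then have "y \<in> {f. \<forall>x. x \<notin> K \<longrightarrow> f x = False}"
      unfolding coin_pmf_def by (rule subsetD[OF set_Pi_pmf_subset[OF assms]])
    then show "y \<in> ?Om" by (simp add: PiE_dflt_def)
  qed
  show "countable ?Om" using assms by (intro countable_finite) auto
  fix f assume f: "f \<in> ?Om"
  then have pre: "mask K -` {f} = {\<omega>. \<forall>k\<in>K. \<omega> k \<in> {f k}}"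
    unfolding mask_preimage by (auto simp: PiE_dflt_def)
  have "emeasure (distr (coin_space p) (count_space UNIV) (mask K)) {f} =
      emeasure (coin_space p) {\<omega>. \<forall>k\<in>K. \<omega> k \<in> {f k}}"
    using mask_measurable[OF assms]
    by (subst emeasure_distr) (simp_all add: pre space_coin_space)
  also have "\<dots> = pmf (coin_pmf p K) f"
    unfolding coin_cylinder(2)[OF assms] coin_pmf_def
    using assms f by (subst pmf_Pi') (auto simp: PiE_dflt_def)
  finally show "emeasure (distr (coin_space p) (count_space UNIV) (mask K)) {f} =
      emeasure (measure_pmf (coin_pmf p K)) {f}"
    by (simp add: emeasure_pmf_single)
qed simp_all

lemma nn_integral_coin_space:
  fixes F :: "(nat \<times> 'a \<Rightarrow> bool) \<Rightarrow> ennreal"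
  assumes "finite K" "\<And>\<omega>. F (mask K \<omega>) = F \<omega>"
  shows "F \<in> borel_measurable (coin_space p)"
    and "(\<integral>\<^sup>+\<omega>. F \<omega> \<partial>coin_space p) = (\<integral>\<^sup>+f. F f \<partial>coin_pmf p K)"
proof -
  have "(\<lambda>\<omega>. F (mask K \<omega>)) \<in> borel_measurable (coin_space p)"
    by (rule measurable_compose[OF mask_measurable[OF assms(1)]]) simp
  then show "F \<in> borel_measurable (coin_space p)" by (simp add: assms(2))
  have "(\<integral>\<^sup>+f. F f \<partial>coin_pmf p K) = (\<integral>\<^sup>+\<omega>. F (mask K \<omega>) \<partial>coin_space p)"
    unfolding distr_mask[OF assms(1), symmetric]
    by (rule nn_integral_distr[OF mask_measurable[OF assms(1)]]) simp
  then show "(\<integral>\<^sup>+\<omega>. F \<omega> \<partial>coin_space p) = (\<integral>\<^sup>+f. F f \<partial>coin_pmf p K)" by (simp add: assms(2))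
qed

text \<open>Coins read along an injection are again independent with the same law. It extracts the
  coins that decide the deletions from the coins of all covers.\<close>

lemma Pi_pmf_reindex_inj:
  assumes K: "finite K" and h: "inj_on h D" "h ` D \<subseteq> K" and out: "z \<notin> K"
  shows "Pi_pmf D dflt (\<lambda>_. q) =
    map_pmf (\<lambda>g j. if j \<in> D then g (h j) else dflt) (Pi_pmf K dflt (\<lambda>_. q))"
proof -
  have D: "finite D" using h K by (meson finite_imageD finite_subset)
  define h' where "h' j = (if j \<in> D then h j else z)" for j
  have "Pi_pmf D dflt (\<lambda>_. q) = map_pmf (\<lambda>g. g \<circ> h') (Pi_pmf (h ` D) dflt (\<lambda>_. q))"
  proof (rule Pi_pmf_bij_betw[OF D])
    have "inj_on h' D" using h(1) by (simp add: h'_def inj_on_def)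
    then show "bij_betw h' D (h ` D)" by (auto simp: bij_betw_def h'_def)
    show "h' x \<notin> h ` D" if "x \<notin> D" for x using out h(2) that by (auto simp: h'_def)
  qed
  also have "Pi_pmf (h ` D) dflt (\<lambda>_. q) =
      map_pmf (\<lambda>f x. if x \<in> h ` D then f x else dflt) (Pi_pmf K dflt (\<lambda>_. q))"
    by (rule Pi_pmf_subset[OF K h(2)])
  finally have "Pi_pmf D dflt (\<lambda>_. q) =
      map_pmf (\<lambda>g j. if h' j \<in> h ` D then g (h' j) else dflt) (Pi_pmf K dflt (\<lambda>_. q))"
    by (simp add: map_pmf_comp o_def)
  moreover have "(if h' j \<in> h ` D then g (h' j) else dflt) = (if j \<in> D then g (h j) else dflt)" for g j
    using out h(2) by (cases "j \<in> D") (auto simp: h'_def)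
  ultimately show ?thesis by simp
qed

text \<open>\<open>X\<close> embeds the order by inclusion, and closure under intersection turns
  every meet taken by the chain into an intersection. A step can then be described by the elements
  that it deletes.\<close>

locale set_lattice =
  fixes L :: "('a, 'b) gorder_scheme" and X :: "'a \<Rightarrow> 'i set"
  assumes fin: "finite (carrier L)"
    and eq_L: "eq L = (=)"
    and le_iff: "x \<in> carrier L \<Longrightarrow> y \<in> carrier L \<Longrightarrow> le L x y \<longleftrightarrow> X x \<subseteq> X y"
    and X_inj: "x \<in> carrier L \<Longrightarrow> y \<in> carrier L \<Longrightarrow> X x = X y \<Longrightarrow> x = y"
    and X_Int: "x \<in> carrier L \<Longrightarrow> y \<in> carrier L \<Longrightarrow> \<exists>z \<in> carrier L. X z = X x \<inter> X y"
    and X_top: "\<exists>t \<in> carrier L. \<forall>x \<in> carrier L. X x \<subseteq> X t"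
    and X_bottom: "\<exists>b \<in> carrier L. X b = {}"
begin

lemma top_props: "\<top>\<^bsub>L\<^esub> \<in> carrier L" "x \<in> carrier L \<Longrightarrow> X x \<subseteq> X \<top>\<^bsub>L\<^esub>"
proof -
  obtain t where "t \<in> carrier L" "\<forall>x \<in> carrier L. X x \<subseteq> X t" using X_top by blast
  then have "greatest L t (carrier L)" by (auto simp: greatest_def le_iff)
  then have g: "greatest L \<top>\<^bsub>L\<^esub> (carrier L)" unfolding top_def by (rule someI)
  then show c: "\<top>\<^bsub>L\<^esub> \<in> carrier L" by (simp add: greatest_def)
  show "x \<in> carrier L \<Longrightarrow> X x \<subseteq> X \<top>\<^bsub>L\<^esub>" using g c le_iff by (simp add: greatest_def)
qed

lemma bottom_props: "\<bottom>\<^bsub>L\<^esub> \<in> carrier L" "X \<bottom>\<^bsub>L\<^esub> = {}"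
proof -
  obtain b where b: "b \<in> carrier L" "X b = {}" using X_bottom by blast
  then have "least L b (carrier L)" by (auto simp: least_def le_iff)
  then have g: "least L \<bottom>\<^bsub>L\<^esub> (carrier L)" unfolding bottom_def by (rule someI)
  then show c: "\<bottom>\<^bsub>L\<^esub> \<in> carrier L" by (simp add: least_def)
  show "X \<bottom>\<^bsub>L\<^esub> = {}" using g c le_iff b by (auto simp: least_def)
qed

lemma Inter_in_family:
  assumes "finite A" "A \<noteq> {}" "A \<subseteq> carrier L"
  shows "\<exists>z \<in> carrier L. X z = (\<Inter>x\<in>A. X x)"
  using assms
proof (induction rule: finite_ne_induct)
  case (insert x A)
  then obtain z where "z \<in> carrier L" "X z = (\<Inter>x\<in>A. X x)" by auto
  then show ?case using X_Int[of x z] insert by auto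
qed auto

lemma inf_props:
  assumes "A \<noteq> {}" "A \<subseteq> carrier L"
  shows "\<Sqinter>\<^bsub>L\<^esub> A \<in> carrier L" "X (\<Sqinter>\<^bsub>L\<^esub> A) = (\<Inter>x\<in>A. X x)"
proof -
  have "finite A" using assms fin finite_subset by blast
  then obtain z where z: "z \<in> carrier L" "X z = (\<Inter>x\<in>A. X x)"
    using Inter_in_family assms by blast
  have low: "Lower L A = {l \<in> carrier L. X l \<subseteq> (\<Inter>x\<in>A. X x)}"
    using assms by (auto simp: Lower_def le_iff subset_iff)
  have "greatest L z (Lower L A)" using z le_iff by (auto simp: greatest_def low)
  then have g: "greatest L (\<Sqinter>\<^bsub>L\<^esub> A) (Lower L A)" unfolding inf_def by (rule someI)
  then show c: "\<Sqinter>\<^bsub>L\<^esub> A \<in> carrier L" by (simp add: greatest_def low)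
  have "X (\<Sqinter>\<^bsub>L\<^esub> A) \<subseteq> (\<Inter>x\<in>A. X x)" using g by (simp add: greatest_def low)
  moreover have "le L z (\<Sqinter>\<^bsub>L\<^esub> A)" using g z unfolding greatest_def low by blast
  then have "X z \<subseteq> X (\<Sqinter>\<^bsub>L\<^esub> A)" using le_iff[OF z(1) c] by blast
  ultimately show "X (\<Sqinter>\<^bsub>L\<^esub> A) = (\<Inter>x\<in>A. X x)" using z by blast
qed

lemma lower_coverI:
  assumes "x \<in> carrier L" "y \<in> carrier L" "j \<in> X x" "X y = X x - {j}"
  shows "y \<in> lower_covers L x"
proof -
  have "y \<noteq> x" using assms by auto
  moreover have False if "z \<in> carrier L" "y \<noteq> z" "z \<noteq> x" "X y \<subseteq> X z" "X z \<subseteq> X x" for z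
  proof -
    have "X z = X y \<or> X z = X x" using that assms by blast
    then show False using that assms X_inj by blast
  qed
  ultimately show ?thesis
    using assms by (auto simp: lower_covers_def lless_def eq_L le_iff)
qed

definition ungarian_step :: "'a \<Rightarrow> ('a \<Rightarrow> bool) \<Rightarrow> 'a" where
  "ungarian_step x b = \<Sqinter>\<^bsub>L\<^esub> ({x} \<union> {y \<in> lower_covers L x. b y})"

lemma ungarian_step_props:
  assumes "x \<in> carrier L"
  shows "ungarian_step x b \<in> carrier L"
    and "X (ungarian_step x b) \<subseteq> X x"
    and "y \<in> lower_covers L x \<Longrightarrow> b y \<Longrightarrow> X (ungarian_step x b) \<subseteq> X y"
proof -
  have "{x} \<union> {y \<in> lower_covers L x. b y} \<subseteq> carrier L"
    using assms by (auto simp: lower_covers_def)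
  then show "ungarian_step x b \<in> carrier L"
    and "X (ungarian_step x b) \<subseteq> X x"
    and "y \<in> lower_covers L x \<Longrightarrow> b y \<Longrightarrow> X (ungarian_step x b) \<subseteq> X y"
    using inf_props[of "{x} \<union> {y \<in> lower_covers L x. b y}"]
    by (auto simp: ungarian_step_def)
qed

lemma ungarian_chain_Suc:
  "ungarian_chain L (Suc t) \<omega> = ungarian_step (ungarian_chain L t \<omega>) (\<lambda>y. \<omega> (t, y))"
  by (simp add: ungarian_step_def Let_def)

lemma ungarian_step_cong:
  assumes "\<And>y. y \<in> carrier L \<Longrightarrow> b y = b' y"
  shows "ungarian_step x b = ungarian_step x b'"
proof -
  have "{y \<in> lower_covers L x. b y} = {y \<in> lower_covers L x. b' y}"
    using assms by (auto simp: lower_covers_def)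
  then show ?thesis by (simp add: ungarian_step_def)
qed

lemma ungarian_chain_in: "ungarian_chain L t \<omega> \<in> carrier L"
proof (induction t)
  case (Suc t)
  then show ?case unfolding ungarian_chain_Suc by (rule ungarian_step_props)
qed (simp add: top_props)

lemma ungarian_chain_cong:
  assumes "\<And>s y. s < t \<Longrightarrow> y \<in> carrier L \<Longrightarrow> \<omega> (s, y) = \<omega>' (s, y)"
  shows "ungarian_chain L t \<omega> = ungarian_chain L t \<omega>'"
  using assms
proof (induction t)
  case (Suc t)
  have eq: "ungarian_chain L t \<omega> = ungarian_chain L t \<omega>'" using Suc by simp
  show ?case
    unfolding ungarian_chain_Suc eq using Suc.prems by (intro ungarian_step_cong) simp
qed simp

text \<open>Trades the hitting time for a series that can be integrated term by term, each term
  depending on finitely many coins.\<close>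

lemma steps_to_bottom_le:
  "steps_to_bottom L \<omega> \<le> (\<Sum>t. indicator {t. ungarian_chain L t \<omega> \<noteq> \<bottom>\<^bsub>L\<^esub>} t)"
proof -
  let ?S = "{t. ungarian_chain L t \<omega> = \<bottom>\<^bsub>L\<^esub>}"
  let ?sum = "\<Sum>t. indicator {t. ungarian_chain L t \<omega> \<noteq> \<bottom>\<^bsub>L\<^esub>} t :: ennreal"
  have le: "of_nat N \<le> ?sum" if "\<And>t. t < N \<Longrightarrow> t \<notin> ?S" for N
  proof -
    have "of_nat N = (\<Sum>t<N. indicator {t. ungarian_chain L t \<omega> \<noteq> \<bottom>\<^bsub>L\<^esub>} t :: ennreal)"
      using that by simp
    also have "\<dots> \<le> ?sum" by (rule sum_le_suminf) auto
    finally show ?thesis .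
  qed
  show ?thesis
  proof (cases "?S = {}")
    case True
    then have "(SUP N. of_nat N :: ennreal) \<le> ?sum" by (intro SUP_least le) simp
    then have "?sum = \<infinity>"
      using ennreal_SUP_of_nat_eq_top by (simp add: top_unique infinity_ennreal_def)
    then show ?thesis by simp
  next
    case False
    then have "(LEAST t. t \<in> ?S) \<in> ?S" using LeastI_ex[of "\<lambda>t. t \<in> ?S"] by blast
    then have "steps_to_bottom L \<omega> \<le> of_nat (LEAST t. t \<in> ?S)"
      unfolding steps_to_bottom_def by (rule INF_lower)
    also have "\<dots> \<le> ?sum" by (intro le) (rule not_less_Least)
    finally show ?thesis .
  qed
qed

text \<open>A drift argument. \<open>D x\<close> holds elements that some cover of \<open>x\<close>
  deletes alone; the true next state is contained in the one obtained by these deletions only, and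
  monotonicity of the potential makes up for the difference. The drift sums to a bound on the
  expected time away from the bottom.\<close>

lemma expected_steps_le_potential:
  fixes \<Psi> :: "'i set \<Rightarrow> ennreal"
  assumes fX: "\<And>x. x \<in> carrier L \<Longrightarrow> finite (X x)"
    and D: "\<And>x j. x \<in> carrier L \<Longrightarrow> j \<in> D x \<Longrightarrow> j \<in> X x \<and> (\<exists>y \<in> carrier L. X y = X x - {j})"
    and mono: "\<And>I J. finite J \<Longrightarrow> I \<subseteq> J \<Longrightarrow> \<Psi> I \<le> \<Psi> J"
    and step: "\<And>x. x \<in> carrier L \<Longrightarrow> X x \<noteq> {} \<Longrightarrow>
      1 + (\<integral>\<^sup>+b. \<Psi> (X x - {j \<in> D x. b j}) \<partial>Pi_pmf (D x) False (\<lambda>_. bernoulli_pmf p)) \<le> \<Psi> (X x)"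
  shows "expected_steps p L \<le> \<Psi> (X \<top>\<^bsub>L\<^esub>)"
proof -
  let ?C = "carrier L"
  define alive :: "nat \<Rightarrow> (nat \<times> 'a \<Rightarrow> bool) \<Rightarrow> ennreal" where
    "alive t \<omega> = indicator {t. ungarian_chain L t \<omega> \<noteq> \<bottom>\<^bsub>L\<^esub>} t" for t \<omega>
  define K where "K t = {..<t} \<times> ?C" for t :: nat
  have finK: "finite (K t)" for t using fin by (simp add: K_def)
  have chain_mask: "ungarian_chain L t (mask (K t) \<omega>) = ungarian_chain L t \<omega>" for t \<omega>
    by (rule ungarian_chain_cong) (simp add: mask_def K_def)
  have alive_mask: "alive t (mask (K t) \<omega>) = alive t \<omega>" for t \<omega>
    by (simp add: alive_def indicator_def chain_mask)
  have one_step: "(if x = \<bottom>\<^bsub>L\<^esub> then 0 else 1) +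
      (\<integral>\<^sup>+g. \<Psi> (X (ungarian_step x (\<lambda>y. g (t, y)))) \<partial>coin_pmf p ({t} \<times> ?C)) \<le> \<Psi> (X x)"
    if x: "x \<in> ?C" for x t
  proof (cases "x = \<bottom>\<^bsub>L\<^esub>")
    case True
    have "(\<integral>\<^sup>+g. \<Psi> (X (ungarian_step x (\<lambda>y. g (t, y)))) \<partial>coin_pmf p ({t} \<times> ?C)) \<le>
        (\<integral>\<^sup>+g. \<Psi> (X x) \<partial>coin_pmf p ({t} \<times> ?C))"
      using x by (intro nn_integral_mono mono fX ungarian_step_props)
    then show ?thesis using True by simp
  next
    case False
    then have ne: "X x \<noteq> {}" using X_inj[OF x bottom_props(1)] bottom_props(2) by auto
    have "\<forall>j \<in> D x. \<exists>y. y \<in> ?C \<and> X y = X x - {j}" using D[OF x] by blast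
    then obtain cov where cov: "\<And>j. j \<in> D x \<Longrightarrow> cov j \<in> ?C \<and> X (cov j) = X x - {j}"
      by metis
    have lc: "cov j \<in> lower_covers L x" if "j \<in> D x" for j
      using lower_coverI[OF x] cov[OF that] D[OF x that] by blast
    \<comment> \<open>Distinct \<open>j\<close> have distinct covers \<open>cov j\<close>, so their
      coins at time \<open>t\<close> are distinct and hence independent.\<close>
    define h where "h j = (t, cov j)" for j
    have inj: "inj_on h (D x)"
    proof (rule inj_onI)
      fix i j assume ij: "i \<in> D x" "j \<in> D x" "h i = h j"
      then have "X x - {i} = X x - {j}" using cov by (metis h_def prod.inject)
      then show "i = j" using D[OF x] ij by blast
    qed
    have Pi: "Pi_pmf (D x) False (\<lambda>_. bernoulli_pmf p) =
        map_pmf (\<lambda>g j. if j \<in> D x then g (h j) else False) (coin_pmf p ({t} \<times> ?C))"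
      unfolding coin_pmf_def
    proof (rule Pi_pmf_reindex_inj)
      show "finite ({t} \<times> ?C)" using fin by simp
      show "h ` D x \<subseteq> {t} \<times> ?C" using cov by (auto simp: h_def)
      show "(Suc t, undefined) \<notin> {t} \<times> ?C" by simp
    qed (rule inj)
    have "X (ungarian_step x (\<lambda>y. g (t, y))) \<subseteq>
        X x - {j \<in> D x. if j \<in> D x then g (h j) else False}" for g
    proof -
      have "X (ungarian_step x (\<lambda>y. g (t, y))) \<subseteq> X x - {j}" if "j \<in> D x" "g (h j)" for j
        using ungarian_step_props(3)[OF x lc[OF that(1)], of "\<lambda>y. g (t, y)"] that cov
        by (simp add: h_def)
      then show ?thesis using ungarian_step_props(2)[OF x] by fastforce
    qed
    then have "(\<integral>\<^sup>+g. \<Psi> (X (ungarian_step x (\<lambda>y. g (t, y)))) \<partial>coin_pmf p ({t} \<times> ?C)) \<le>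
        (\<integral>\<^sup>+b. \<Psi> (X x - {j \<in> D x. b j}) \<partial>Pi_pmf (D x) False (\<lambda>_. bernoulli_pmf p))"
      unfolding Pi nn_integral_map_pmf
      using fX[OF x] by (intro nn_integral_mono mono) auto
    then have "1 + (\<integral>\<^sup>+g. \<Psi> (X (ungarian_step x (\<lambda>y. g (t, y)))) \<partial>coin_pmf p ({t} \<times> ?C)) \<le>
        1 + (\<integral>\<^sup>+b. \<Psi> (X x - {j \<in> D x. b j}) \<partial>Pi_pmf (D x) False (\<lambda>_. bernoulli_pmf p))"
      by (rule add_left_mono)
    also have "\<dots> \<le> \<Psi> (X x)" using step[OF x ne] .
    finally show ?thesis using False by simp
  qed
  have drift: "(\<integral>\<^sup>+f. alive t f \<partial>coin_pmf p (K t)) +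
      (\<integral>\<^sup>+f. \<Psi> (X (ungarian_chain L (Suc t) f)) \<partial>coin_pmf p (K (Suc t))) \<le>
      (\<integral>\<^sup>+f. \<Psi> (X (ungarian_chain L t f)) \<partial>coin_pmf p (K t))" for t
  proof -
    let ?m = "\<lambda>(f, g) k. if k \<in> K t then f k else g k"
    \<comment> \<open>The state at time \<open>t\<close> uses only coins of earlier times, so the
      coins of time \<open>t\<close> are fresh: the Markov property.\<close>
    have "K (Suc t) = K t \<union> {t} \<times> ?C" by (auto simp: K_def less_Suc_eq)
    then have split: "coin_pmf p (K (Suc t)) =
        map_pmf ?m (pair_pmf (coin_pmf p (K t)) (coin_pmf p ({t} \<times> ?C)))"
      unfolding coin_pmf_def using fin finK by (simp only:) (intro Pi_pmf_union, auto simp: K_def)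
    have chain: "ungarian_chain L (Suc t) (?m (f, g)) =
        ungarian_step (ungarian_chain L t f) (\<lambda>y. g (t, y))" for f g
    proof -
      have "ungarian_chain L t (?m (f, g)) = ungarian_chain L t f"
        by (rule ungarian_chain_cong) (simp add: K_def)
      then show ?thesis unfolding ungarian_chain_Suc by (simp add: K_def)
    qed
    have "(\<integral>\<^sup>+f. \<Psi> (X (ungarian_chain L (Suc t) f)) \<partial>coin_pmf p (K (Suc t))) =
        (\<integral>\<^sup>+f. \<integral>\<^sup>+g. \<Psi> (X (ungarian_step (ungarian_chain L t f) (\<lambda>y. g (t, y))))
          \<partial>coin_pmf p ({t} \<times> ?C) \<partial>coin_pmf p (K t))"
      unfolding split nn_integral_map_pmf nn_integral_pair_pmf' chain ..
    then have "(\<integral>\<^sup>+f. alive t f \<partial>coin_pmf p (K t)) +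
        (\<integral>\<^sup>+f. \<Psi> (X (ungarian_chain L (Suc t) f)) \<partial>coin_pmf p (K (Suc t))) =
        (\<integral>\<^sup>+f. alive t f + (\<integral>\<^sup>+g. \<Psi> (X (ungarian_step (ungarian_chain L t f) (\<lambda>y. g (t, y))))
          \<partial>coin_pmf p ({t} \<times> ?C)) \<partial>coin_pmf p (K t))"
      by (simp add: nn_integral_add)
    also have "\<dots> \<le> (\<integral>\<^sup>+f. \<Psi> (X (ungarian_chain L t f)) \<partial>coin_pmf p (K t))"
    proof (rule nn_integral_mono)
      fix f
      have "alive t f = (if ungarian_chain L t f = \<bottom>\<^bsub>L\<^esub> then 0 else 1)"
        by (simp add: alive_def indicator_def)
      then show "alive t f + (\<integral>\<^sup>+g. \<Psi> (X (ungarian_step (ungarian_chain L t f) (\<lambda>y. g (t, y))))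
          \<partial>coin_pmf p ({t} \<times> ?C)) \<le> \<Psi> (X (ungarian_chain L t f))"
        using one_step[OF ungarian_chain_in] by simp
    qed
    finally show ?thesis .
  qed
  \<comment> \<open>The drift inequalities telescope; the remaining potential is discarded at the
    end.\<close>
  have partial: "(\<Sum>t<N. \<integral>\<^sup>+f. alive t f \<partial>coin_pmf p (K t)) +
      (\<integral>\<^sup>+f. \<Psi> (X (ungarian_chain L N f)) \<partial>coin_pmf p (K N)) \<le> \<Psi> (X \<top>\<^bsub>L\<^esub>)" for N
  proof (induction N)
    case (Suc N)
    show ?case
      unfolding sum.lessThan_Suc add.assoc
      using add_left_mono[OF drift[of N], of "\<Sum>t<N. \<integral>\<^sup>+f. alive t f \<partial>coin_pmf p (K t)"] Suc
      by (rule order_trans)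
  qed simp
  have alive_coin: "alive t \<in> borel_measurable (coin_space p)"
    "(\<integral>\<^sup>+\<omega>. alive t \<omega> \<partial>coin_space p) = (\<integral>\<^sup>+f. alive t f \<partial>coin_pmf p (K t))" for t
    using nn_integral_coin_space[where F = "alive t" and p = p, OF finK[of t]] alive_mask by blast+
  have "expected_steps p L \<le> (\<integral>\<^sup>+\<omega>. (\<Sum>t. alive t \<omega>) \<partial>coin_space p)"
    unfolding expected_steps_def alive_def by (intro nn_integral_mono steps_to_bottom_le)
  also have "\<dots> = (\<Sum>t. \<integral>\<^sup>+\<omega>. alive t \<omega> \<partial>coin_space p)"
    by (rule nn_integral_suminf) (rule alive_coin)
  also have "\<dots> = (\<Sum>t. \<integral>\<^sup>+f. alive t f \<partial>coin_pmf p (K t))"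
    by (simp only: alive_coin(2))
  also have "\<dots> = (SUP N. \<Sum>t<N. \<integral>\<^sup>+f. alive t f \<partial>coin_pmf p (K t))"
    by (rule suminf_eq_SUP)
  also have "\<dots> \<le> \<Psi> (X \<top>\<^bsub>L\<^esub>)"
    using partial by (intro SUP_least) (meson le_iff_add order_trans)
  finally show ?thesis .
qed

end

section \<open>Last-passage percolation\<close>

definition below :: "nat \<times> nat \<Rightarrow> nat \<times> nat \<Rightarrow> bool" where
  "below x y \<longleftrightarrow> fst x \<le> fst y \<and> snd x \<le> snd y"

definition pchain :: "(nat \<times> nat) set \<Rightarrow> bool" where
  "pchain C \<longleftrightarrow> (\<forall>x\<in>C. \<forall>y\<in>C. below x y \<or> below y x)"

definition maximals :: "(nat \<times> nat) set \<Rightarrow> (nat \<times> nat) set" where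
  "maximals I = {x \<in> I. \<forall>y\<in>I. below x y \<longrightarrow> y = x}"

text \<open>The last-passage time, over chains instead of lattice paths so that it makes sense for
  an arbitrary finite set of points.\<close>

definition passage :: "(nat \<times> nat) set \<Rightarrow> (nat \<times> nat \<Rightarrow> nat) \<Rightarrow> nat" where
  "passage I W = Max (sum W ` {C. C \<subseteq> I \<and> pchain C})"

text \<open>\<open>geometric_pmf\<close> counts failures; \<open>Suc\<close> turns this into the
  number of tosses up to the first success.\<close>

definition passage_mean :: "real \<Rightarrow> (nat \<times> nat) set \<Rightarrow> ennreal" where
  "passage_mean p I =
    (\<integral>\<^sup>+W. of_nat (passage I W) \<partial>Pi_pmf I 0 (\<lambda>_. map_pmf Suc (geometric_pmf p)))"

lemma pchain_empty [simp]: "pchain {}"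
  by (simp add: pchain_def)

lemma pchain_subset: "pchain C \<Longrightarrow> B \<subseteq> C \<Longrightarrow> pchain B"
  by (auto simp: pchain_def)

lemma passage_ge: "finite I \<Longrightarrow> C \<subseteq> I \<Longrightarrow> pchain C \<Longrightarrow> sum W C \<le> passage I W"
  unfolding passage_def by (intro Max_ge) auto

lemma passage_leI:
  assumes "finite I" "\<And>C. C \<subseteq> I \<Longrightarrow> pchain C \<Longrightarrow> sum W C \<le> m"
  shows "passage I W \<le> m"
  unfolding passage_def using assms by (subst Max_le_iff) (auto intro: exI[of _ "{}"])

lemma passage_attained:
  assumes "finite I"
  obtains C where "C \<subseteq> I" "pchain C" "passage I W = sum W C"
proof -
  have "passage I W \<in> sum W ` {C. C \<subseteq> I \<and> pchain C}"
    unfolding passage_def using assms by (intro Max_in) (auto intro: exI[of _ "{}"])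
  then show thesis using that by auto
qed

lemma passage_cong:
  assumes "\<And>x. x \<in> I \<Longrightarrow> W x = W' x"
  shows "passage I W = passage I W'"
proof -
  have "sum W ` {C. C \<subseteq> I \<and> pchain C} = sum W' ` {C. C \<subseteq> I \<and> pchain C}"
    using assms by (intro image_cong refl sum.cong) auto
  then show ?thesis by (simp add: passage_def)
qed

lemma passage_mono:
  assumes "finite J" "I \<subseteq> J"
  shows "passage I W \<le> passage J W"
  using assms by (intro passage_leI passage_ge) (auto intro: finite_subset)

text \<open>Puts the passage times of all subsets of \<open>J\<close> on one family of weights,
  where they can be compared pointwise.\<close>

lemma passage_mean_superset:
  assumes "finite J" "I \<subseteq> J"
  shows "passage_mean p I =
    (\<integral>\<^sup>+W. of_nat (passage I W) \<partial>Pi_pmf J 0 (\<lambda>_. map_pmf Suc (geometric_pmf p)))"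
proof -
  have "passage I (\<lambda>x. if x \<in> I then W x else 0) = passage I W" for W
    by (rule passage_cong) simp
  then show ?thesis
    unfolding passage_mean_def by (subst Pi_pmf_subset[OF assms]) simp
qed

lemma passage_mean_mono:
  assumes "finite J" "I \<subseteq> J"
  shows "passage_mean p I \<le> passage_mean p J"
  unfolding passage_mean_superset[OF assms] passage_mean_def[of p J]
  by (intro nn_integral_mono) (simp add: passage_mono[OF assms])

lemma exists_maximal_above:
  assumes "finite I" "x \<in> I"
  shows "\<exists>m \<in> maximals I. below x m"
proof -
  let ?U = "{y \<in> I. below x y}"
  let ?s = "\<lambda>y. fst y + snd y"
  have fin: "finite ?U" using assms by simp
  have "x \<in> ?U" using assms by (simp add: below_def)
  then have "Max (?s ` ?U) \<in> ?s ` ?U" using fin by (intro Max_in) blast+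
  then obtain m where m: "m \<in> ?U" and mx: "?s m = Max (?s ` ?U)" by (metis (lifting) imageE)
  have max: "?s y \<le> ?s m" if "y \<in> ?U" for y
    unfolding mx by (intro Max_ge finite_imageI fin imageI that)
  have "m \<in> maximals I"
  proof -
    have "y = m" if "y \<in> I" "below m y" for y
    proof -
      have "y \<in> ?U" using that m unfolding below_def mem_Collect_eq by (meson order_trans)
      then have "fst y + snd y \<le> fst m + snd m" by (rule max)
      then show ?thesis using that(2) by (simp add: below_def prod_eq_iff)
    qed
    then show ?thesis using m unfolding maximals_def by blast
  qed
  then show ?thesis using m by blast
qed

lemma pchain_top:
  assumes "finite C" "C \<noteq> {}" "pchain C"
  obtains t where "t \<in> C" "\<And>x. x \<in> C \<Longrightarrow> below x t"
proof -
  obtain y where "y \<in> C" using assms by blast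
  then obtain t where t: "t \<in> maximals C" using exists_maximal_above[OF assms(1)] by blast
  have "below x t" if "x \<in> C" for x
    using t assms(3) that unfolding maximals_def pchain_def by blast
  moreover have "t \<in> C" using t unfolding maximals_def by blast
  ultimately show thesis using that by blast
qed

text \<open>One unit of time removes one unit of weight from every maximal element, so each chain of
  what remains extends to a chain of \<open>I\<close> that is heavier by at least one.\<close>

lemma passage_decrease:
  assumes fin: "finite I" and ne: "I \<noteq> {}"
    and W: "\<And>x. x \<in> I \<Longrightarrow>
      W x = (if x \<in> maximals I then if b x then 1 else Suc (W' x) else W' x)"
  shows "1 + passage (I - {x \<in> maximals I. b x}) W' \<le> passage I W"
proof -
  let ?I' = "I - {x \<in> maximals I. b x}"
  have "finite ?I'" using fin by simp
  then obtain C where C: "C \<subseteq> ?I'" "pchain C" "passage ?I' W' = sum W' C"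
    by (rule passage_attained)
  have finC: "finite C" using C(1) fin finite_subset by blast
  have CI: "C \<subseteq> I" using C(1) by blast
  have le: "W' x \<le> W x" if "x \<in> C" for x
  proof -
    have "x \<in> I" "\<not> (x \<in> maximals I \<and> b x)" using C(1) that by blast+
    then show ?thesis using W[of x] by simp
  qed
  \<comment> \<open>A maximal element of \<open>C\<close> was not deleted, so its weight before the
    step is larger by one. If \<open>C\<close> has none, a maximal element of \<open>I\<close> above
    its top can be added, of weight at least one.\<close>
  have ex: "\<exists>D \<subseteq> I. pchain D \<and> 1 + sum W' C \<le> sum W D"
  proof (cases "C \<inter> maximals I = {}")
    case False
    then obtain m where m: "m \<in> C" "m \<in> maximals I" by blast
    then have "m \<in> I" "\<not> b m" using C(1) by blast+
    then have "W m = Suc (W' m)" using W[of m] m(2) by simp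
    moreover have "sum W' (C - {m}) \<le> sum W (C - {m})" using le by (intro sum_mono) simp
    ultimately have "1 + sum W' C \<le> sum W C"
      using m finC by (simp add: sum.remove[of C m])
    then show ?thesis using CI C(2) by blast
  next
    case True
    obtain m where m: "m \<in> maximals I" "\<And>x. x \<in> C \<Longrightarrow> below x m"
    proof (cases "C = {}")
      case True
      obtain x where "x \<in> I" using ne by blast
      then obtain m where "m \<in> maximals I" using exists_maximal_above[OF fin] by blast
      then show thesis using that True by blast
    next
      case False
      obtain t where t: "t \<in> C" "\<And>x. x \<in> C \<Longrightarrow> below x t"
        using pchain_top[OF finC False C(2)] by blast
      obtain m where "m \<in> maximals I" "below t m"
        using exists_maximal_above[OF fin, of t] t(1) CI by blast
      moreover have "below x m" if "x \<in> C" for x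
        using t(2)[OF that] \<open>below t m\<close> unfolding below_def by (meson order_trans)
      ultimately show thesis using that by blast
    qed
    have mI: "m \<in> I" "m \<notin> C" using m(1) True unfolding maximals_def by blast+
    have "1 \<le> W m" using W[OF mI(1)] m(1) by simp
    moreover have "sum W' C \<le> sum W C" using le by (intro sum_mono)
    ultimately have "1 + sum W' C \<le> sum W (insert m C)" using finC mI by simp
    moreover have "pchain (insert m C)"
      using C(2) m(2) unfolding pchain_def by (metis below_def insert_iff order_refl)
    ultimately show ?thesis using CI mI by blast
  qed
  then obtain D where "D \<subseteq> I" "pchain D" "1 + sum W' C \<le> sum W D" by blast
  then show ?thesis using passage_ge[OF fin, of D W] C(3) by simp
qed

lemma Suc_geometric_bind:
  assumes "0 < p" "p \<le> 1"
  shows "map_pmf Suc (geometric_pmf p) = bind_pmf (bernoulli_pmf p)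
    (\<lambda>b. if b then return_pmf 1 else map_pmf Suc (map_pmf Suc (geometric_pmf p)))"
proof -
  have "map_pmf Suc (geometric_pmf p) = map_pmf Suc (bind_pmf (bernoulli_pmf p)
      (\<lambda>b. if b then return_pmf 0 else map_pmf Suc (geometric_pmf p)))"
    using geometric_bind_pmf_unfold[of p] assms by simp
  also have "\<dots> = bind_pmf (bernoulli_pmf p)
      (\<lambda>b. if b then return_pmf 1 else map_pmf Suc (map_pmf Suc (geometric_pmf p)))"
    unfolding map_bind_pmf by (intro bind_pmf_cong refl) auto
  finally show ?thesis .
qed

text \<open>Memorylessness on \<open>M\<close>: the first toss is split off, and after a failure the
  remaining count has the original law and is independent of that toss.\<close>

lemma Pi_Suc_geometric_split:
  fixes I M :: "(nat \<times> nat) set"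
  assumes p: "0 < p" "p \<le> 1" and fin: "finite I" and M: "M \<subseteq> I"
  defines "G \<equiv> map_pmf Suc (geometric_pmf p)"
  shows "Pi_pmf I 0 (\<lambda>_. G) =
    do {b \<leftarrow> Pi_pmf M False (\<lambda>_. bernoulli_pmf p);
        W \<leftarrow> Pi_pmf I 0 (\<lambda>_. G);
        return_pmf (\<lambda>x. if x \<in> I then if x \<in> M then if b x then 1 else Suc (W x) else W x else 0)}"
proof -
  define q :: "nat \<times> nat \<Rightarrow> bool \<Rightarrow> nat pmf" where
    "q x b = (if x \<in> M then if b then return_pmf 1 else map_pmf Suc G else G)" for x b
  define h where "h b x k = (if x \<in> M then if b x then 1 else Suc k else k)"
    for b :: "nat \<times> nat \<Rightarrow> bool" and x and k :: nat
  \<comment> \<open>Off \<open>M\<close> a constant coin stands in, so that all coordinates have the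
    same form and a single \<open>Pi_pmf_bind\<close> applies.\<close>
  have G: "G = bind_pmf (if x \<in> M then bernoulli_pmf p else return_pmf False) (q x)" for x
  proof (cases "x \<in> M")
    case True
    then have "q x = (\<lambda>b. if b then return_pmf 1 else map_pmf Suc G)" by (simp add: q_def fun_eq_iff)
    then show ?thesis using Suc_geometric_bind[OF p, folded G_def] True by simp
  qed (simp add: q_def bind_return_pmf)
  have q: "q x (b x) = bind_pmf G (\<lambda>k. return_pmf (h b x k))" for b x
    by (simp add: q_def h_def map_pmf_def bind_return_pmf')
  have "Pi_pmf I 0 (\<lambda>_. G) =
      Pi_pmf I 0 (\<lambda>x. bind_pmf (if x \<in> M then bernoulli_pmf p else return_pmf False) (q x))"
    by (rule Pi_pmf_cong[OF refl refl]) (rule G)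
  also have "\<dots> = bind_pmf (Pi_pmf I False (\<lambda>x. if x \<in> M then bernoulli_pmf p else return_pmf False))
      (\<lambda>b. Pi_pmf I 0 (\<lambda>x. q x (b x)))"
    by (rule Pi_pmf_bind[OF fin])
  also have "Pi_pmf I False (\<lambda>x. if x \<in> M then bernoulli_pmf p else return_pmf False) =
      Pi_pmf M False (\<lambda>_. bernoulli_pmf p)"
  proof -
    have "{x \<in> I. x \<in> M} = M" using M by blast
    then show ?thesis using Pi_pmf_if_set[OF fin, of False "\<lambda>x. x \<in> M"] by simp
  qed
  also have "(\<lambda>b. Pi_pmf I 0 (\<lambda>x. q x (b x))) =
      (\<lambda>b. bind_pmf (Pi_pmf I 0 (\<lambda>_. G)) (\<lambda>W. return_pmf (\<lambda>x. if x \<in> I then h b x (W x) else 0)))"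
    unfolding q by (subst Pi_pmf_bind[OF fin, where d' = 0]) (simp add: fin)
  finally show ?thesis unfolding h_def .
qed

text \<open>The coins of the chain are coupled with the first tosses of the maximal weights;
  \<open>passage_decrease\<close> then holds pointwise.\<close>

lemma passage_mean_step:
  assumes p: "0 < p" "p \<le> 1" and fin: "finite I" and ne: "I \<noteq> {}"
  shows "1 + (\<integral>\<^sup>+b. passage_mean p (I - {x \<in> maximals I. b x})
      \<partial>Pi_pmf (maximals I) False (\<lambda>_. bernoulli_pmf p)) \<le> passage_mean p I"
proof -
  let ?M = "maximals I" and ?G = "map_pmf Suc (geometric_pmf p)"
  let ?B = "Pi_pmf ?M False (\<lambda>_. bernoulli_pmf p)" and ?P = "Pi_pmf I 0 (\<lambda>_. ?G)"
  let ?W = "\<lambda>b W x. if x \<in> I then if x \<in> ?M then if b x then 1 else Suc (W x) else W x else 0"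
  have M: "?M \<subseteq> I" by (auto simp: maximals_def)
  have "1 + (\<integral>\<^sup>+b. passage_mean p (I - {x \<in> ?M. b x}) \<partial>?B) =
      1 + (\<integral>\<^sup>+b. \<integral>\<^sup>+W. of_nat (passage (I - {x \<in> ?M. b x}) W) \<partial>?P \<partial>?B)"
    using passage_mean_superset[OF fin] by (simp only: Diff_subset)
  also have "\<dots> = (\<integral>\<^sup>+b. \<integral>\<^sup>+W. of_nat (1 + passage (I - {x \<in> ?M. b x}) W) \<partial>?P \<partial>?B)"
    by (simp add: nn_integral_add)
  also have "\<dots> \<le> (\<integral>\<^sup>+b. \<integral>\<^sup>+W. of_nat (passage I (?W b W)) \<partial>?P \<partial>?B)"
    by (intro nn_integral_mono of_nat_mono passage_decrease[OF fin ne]) auto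
  also have "\<dots> = passage_mean p I"
    unfolding passage_mean_def by (subst (2) Pi_Suc_geometric_split[OF p fin M]) simp
  finally show ?thesis .
qed

section \<open>The stationary boundary\<close>

text \<open>Works in place: cell \<open>(i, 0)\<close> holds the current horizontal increment,
  \<open>(0, j)\<close> the vertical one, and the bulk weight is replaced by its dual. Truncated
  subtraction is the positive part.\<close>

definition corner_flip :: "nat \<Rightarrow> nat \<Rightarrow> (nat \<times> nat \<Rightarrow> nat) \<Rightarrow> nat \<times> nat \<Rightarrow> nat" where
  "corner_flip i j f = f((i, 0) := f (i, j) + (f (i, 0) - f (0, j)),
    (0, j) := f (i, j) + (f (0, j) - f (i, 0)), (i, j) := min (f (i, 0)) (f (0, j)))"

lemma corner_flip_corner_flip:
  assumes "1 \<le> i" "1 \<le> j"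
  shows "corner_flip i j (corner_flip i j f) = f"
  using assms by (auto simp: corner_flip_def fun_eq_iff)

definition boundary_box :: "nat \<Rightarrow> (nat \<times> nat) set" where
  "boundary_box n = {0..n} \<times> {0..n} - {(0, 0)}"

text \<open>The densities are proportional to \<open>a ^ k\<close> on the axes and
  \<open>(a\<^sup>2) ^ k\<close> inside, so the bulk ratio is the product of the two boundary
  ratios.\<close>

definition box_law :: "real \<Rightarrow> nat \<times> nat \<Rightarrow> nat pmf" where
  "box_law a x = geometric_pmf (if fst x = 0 \<or> snd x = 0 then 1 - a else 1 - a\<^sup>2)"

definition box_pmf :: "real \<Rightarrow> nat \<Rightarrow> (nat \<times> nat \<Rightarrow> nat) pmf" where
  "box_pmf a n = Pi_pmf (boundary_box n) 0 (box_law a)"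

lemma finite_boundary_box [simp]: "finite (boundary_box n)"
  by (simp add: boundary_box_def)

lemma map_pmf_involution:
  assumes inv: "\<And>x. f (f x) = x" and pmf: "\<And>x. pmf P (f x) = pmf P x"
  shows "map_pmf f P = P"
proof (rule pmf_eqI)
  fix x
  have "inj f" by (metis injI inv)
  then have "pmf (map_pmf f P) (f (f x)) = pmf P (f x)" by (rule pmf_map_inj')
  then show "pmf (map_pmf f P) x = pmf P x" by (simp add: inv pmf)
qed

text \<open>Burke's theorem: \<open>(I, J, w) \<mapsto> (w + (I - J)\<^sup>+, w + (J - I)\<^sup>+, min I J)\<close> is an involution that
  preserves \<open>I + J + 2w\<close>, hence the density \<open>a\<^sup>I a\<^sup>J (a\<^sup>2)\<^sup>w\<close>.\<close>

lemma corner_flip_box_pmf: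
  assumes a: "0 \<le> a" "a < 1" and ij: "1 \<le> i" "i \<le> n" "1 \<le> j" "j \<le> n"
  shows "map_pmf (corner_flip i j) (box_pmf a n) = box_pmf a n"
proof (rule map_pmf_involution)
  show "corner_flip i j (corner_flip i j f) = f" for f
    using ij by (intro corner_flip_corner_flip)
  fix f
  let ?g = "corner_flip i j f"
  let ?A = "boundary_box n"
  have in_A: "(i, 0) \<in> ?A" "(0, j) \<in> ?A" "(i, j) \<in> ?A"
    using ij by (auto simp: boundary_box_def)
  have same: "?g x = f x" if "x \<noteq> (i, 0)" "x \<noteq> (0, j)" "x \<noteq> (i, j)" for x
    using that by (simp add: corner_flip_def)
  have out: "(\<forall>x. x \<notin> ?A \<longrightarrow> ?g x = 0) \<longleftrightarrow> (\<forall>x. x \<notin> ?A \<longrightarrow> f x = 0)"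
    using in_A same by metis
  have "a\<^sup>2 < 1" using a by (simp add: power_less_one_iff abs_square_less_1)
  then have pmfs: "pmf (box_law a (i, 0)) k = a ^ k * (1 - a)" "pmf (box_law a (0, j)) k = a ^ k * (1 - a)"
    "pmf (box_law a (i, j)) k = a ^ (2 * k) * (1 - a\<^sup>2)" for k
    using a ij by (simp_all add: box_law_def power_mult)
  let ?B = "?A - {(i, 0)} - {(0, j)} - {(i, j)}"
  have split: "(\<Prod>x\<in>?A. pmf (box_law a x) (h x)) =
      a ^ (h (i, 0) + h (0, j) + 2 * h (i, j)) * ((1 - a) * (1 - a) * (1 - a\<^sup>2)) *
      (\<Prod>x\<in>?B. pmf (box_law a x) (h x))" for h
  proof -
    have "(\<Prod>x\<in>?A. pmf (box_law a x) (h x)) = pmf (box_law a (i, 0)) (h (i, 0)) *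
        (pmf (box_law a (0, j)) (h (0, j)) * (pmf (box_law a (i, j)) (h (i, j)) *
        (\<Prod>x\<in>?B. pmf (box_law a x) (h x))))"
      using in_A ij by (simp add: prod.remove[of _ "(i, 0)"] prod.remove[of _ "(0, j)"] prod.remove[of _ "(i, j)"])
    then show ?thesis unfolding pmfs by (simp add: power_add mult_ac)
  qed
  have B: "(\<Prod>x\<in>?B. pmf (box_law a x) (?g x)) = (\<Prod>x\<in>?B. pmf (box_law a x) (f x))"
    by (intro prod.cong refl) (simp add: same)
  have "?g (i, 0) + ?g (0, j) + 2 * ?g (i, j) = f (i, 0) + f (0, j) + 2 * f (i, j)"
    using ij by (simp add: corner_flip_def)
  then show "pmf (box_pmf a n) ?g = pmf (box_pmf a n) f"
    unfolding box_pmf_def pmf_Pi[OF finite_boundary_box] out split B by (simp only:)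
qed

section \<open>Sweeping the square by corner flips\<close>

fun flip_row :: "nat \<Rightarrow> nat \<Rightarrow> (nat \<times> nat \<Rightarrow> nat) \<Rightarrow> nat \<times> nat \<Rightarrow> nat" where
  "flip_row j 0 f = f"
| "flip_row j (Suc i) f = corner_flip (Suc i) j (flip_row j i f)"

fun flip_rows :: "nat \<Rightarrow> nat \<Rightarrow> (nat \<times> nat \<Rightarrow> nat) \<Rightarrow> nat \<times> nat \<Rightarrow> nat" where
  "flip_rows n 0 f = f"
| "flip_rows n (Suc j) f = flip_row (Suc j) n (flip_rows n j f)"

lemma flip_row_box_pmf:
  assumes "0 \<le> a" "a < 1" "1 \<le> j" "j \<le> n" "i \<le> n"
  shows "map_pmf (flip_row j i) (box_pmf a n) = box_pmf a n"
  using assms(5)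
proof (induction i)
  case 0
  have "flip_row j 0 = (\<lambda>f. f)" by auto
  then show ?case by simp
next
  case (Suc i)
  have "flip_row j (Suc i) = corner_flip (Suc i) j \<circ> flip_row j i" by auto
  then have "map_pmf (flip_row j (Suc i)) (box_pmf a n) =
      map_pmf (corner_flip (Suc i) j) (map_pmf (flip_row j i) (box_pmf a n))"
    by (simp add: pmf.map_comp)
  also have "\<dots> = map_pmf (corner_flip (Suc i) j) (box_pmf a n)" using Suc by simp
  also have "\<dots> = box_pmf a n" using Suc.prems assms by (intro corner_flip_box_pmf) auto
  finally show ?case .
qed

lemma flip_rows_box_pmf:
  assumes "0 \<le> a" "a < 1" "j \<le> n"
  shows "map_pmf (flip_rows n j) (box_pmf a n) = box_pmf a n"
  using assms(3)
proof (induction j)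
  case 0
  have "flip_rows n 0 = (\<lambda>f. f)" by auto
  then show ?case by simp
next
  case (Suc j)
  have "flip_rows n (Suc j) = flip_row (Suc j) n \<circ> flip_rows n j" by auto
  then have "map_pmf (flip_rows n (Suc j)) (box_pmf a n) =
      map_pmf (flip_row (Suc j) n) (map_pmf (flip_rows n j) (box_pmf a n))"
    by (simp add: pmf.map_comp)
  also have "\<dots> = map_pmf (flip_row (Suc j) n) (box_pmf a n)" using Suc by simp
  also have "\<dots> = box_pmf a n" using Suc.prems assms by (intro flip_row_box_pmf) auto
  finally show ?case .
qed

text \<open>With \<open>G\<close> the last-passage time to a point, these are its increments
  \<open>G(i, j) - G(i - 1, j)\<close> and \<open>G(i, j) - G(i, j - 1)\<close>; the recursion is
  \<open>G(i, j) = f (i, j) + max (G(i - 1, j)) (G(i, j - 1))\<close> rewritten in terms of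
  them.\<close>

fun hor :: "(nat \<times> nat \<Rightarrow> nat) \<Rightarrow> nat \<Rightarrow> nat \<Rightarrow> nat"
  and ver :: "(nat \<times> nat \<Rightarrow> nat) \<Rightarrow> nat \<Rightarrow> nat \<Rightarrow> nat" where
  "hor f 0 j = 0"
| "hor f (Suc i) 0 = f (Suc i, 0)"
| "hor f (Suc i) (Suc j) = f (Suc i, Suc j) + (hor f (Suc i) j - ver f i (Suc j))"
| "ver f i 0 = 0"
| "ver f 0 (Suc j) = f (0, Suc j)"
| "ver f (Suc i) (Suc j) = f (Suc i, Suc j) + (ver f i (Suc j) - hor f (Suc i) j)"

text \<open>The contents of \<open>g\<close> after \<open>j\<close> full rows and \<open>i\<close>
  corners of row \<open>Suc j\<close>: the axes carry the increments along the frontier of the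
  sweep, and the bulk cells still ahead are untouched.\<close>

definition flip_invariant ::
  "nat \<Rightarrow> (nat \<times> nat \<Rightarrow> nat) \<Rightarrow> nat \<Rightarrow> nat \<Rightarrow> (nat \<times> nat \<Rightarrow> nat) \<Rightarrow> bool" where
  "flip_invariant n f j i g \<longleftrightarrow>
    (\<forall>x. 1 \<le> x \<longrightarrow> x \<le> n \<longrightarrow> g (x, 0) = (if x \<le> i then hor f x (Suc j) else hor f x j)) \<and>
    (\<forall>y. 1 \<le> y \<longrightarrow> g (0, y) =
      (if y \<le> j then ver f n y else if y = Suc j then ver f i y else f (0, y))) \<and>
    (\<forall>x y. 1 \<le> x \<longrightarrow> Suc j < y \<or> y = Suc j \<and> i < x \<longrightarrow> g (x, y) = f (x, y))"

lemma flip_invariant_start: "flip_invariant n f 0 0 f"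
proof -
  have "f (x, 0) = hor f x 0" if "1 \<le> x" for x using that by (cases x) auto
  then show ?thesis by (auto simp: flip_invariant_def)
qed

lemma flip_invariant_step:
  assumes inv: "flip_invariant n f j i g" and i: "i < n"
  shows "flip_invariant n f j (Suc i) (corner_flip (Suc i) (Suc j) g)"
proof -
  have g: "g (Suc i, 0) = hor f (Suc i) j" "g (0, Suc j) = ver f i (Suc j)"
    "g (Suc i, Suc j) = f (Suc i, Suc j)"
    using inv i by (auto simp: flip_invariant_def)
  let ?g = "corner_flip (Suc i) (Suc j) g"
  have new: "?g (Suc i, 0) = hor f (Suc i) (Suc j)" "?g (0, Suc j) = ver f (Suc i) (Suc j)"
    by (simp_all add: corner_flip_def g)
  have old: "?g x = g x" if "x \<noteq> (Suc i, 0)" "x \<noteq> (0, Suc j)" "x \<noteq> (Suc i, Suc j)" for x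
    using that by (simp add: corner_flip_def)
  show ?thesis
    unfolding flip_invariant_def
  proof (intro conjI allI impI)
    fix x assume "1 \<le> x" "x \<le> n"
    then show "?g (x, 0) = (if x \<le> Suc i then hor f x (Suc j) else hor f x j)"
      using inv new(1) old[of "(x, 0)"] by (cases "x = Suc i") (auto simp: flip_invariant_def)
  next
    fix y :: nat assume "1 \<le> y"
    then show "?g (0, y) = (if y \<le> j then ver f n y else if y = Suc j then ver f (Suc i) y else f (0, y))"
      using inv new(2) old[of "(0, y)"] by (cases "y = Suc j") (auto simp: flip_invariant_def)
  next
    fix x y assume "1 \<le> x" "Suc j < y \<or> y = Suc j \<and> Suc i < x"
    then show "?g (x, y) = f (x, y)"
      using inv old[of "(x, y)"] by (auto simp: flip_invariant_def)
  qed
qed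

lemma flip_invariant_next_row:
  assumes "flip_invariant n f j n g"
  shows "flip_invariant n f (Suc j) 0 g"
  using assms unfolding flip_invariant_def by (auto simp: le_Suc_eq)

lemma flip_invariant_row:
  "flip_invariant n f j 0 g \<Longrightarrow> i \<le> n \<Longrightarrow> flip_invariant n f j i (flip_row (Suc j) i g)"
  by (induction i) (simp_all add: flip_invariant_step)

lemma flip_invariant_rows: "flip_invariant n f j 0 (flip_rows n j f)"
  by (induction j) (simp_all add: flip_invariant_start flip_invariant_next_row flip_invariant_row)

lemma flip_rows_boundary: "1 \<le> y \<Longrightarrow> y \<le> j \<Longrightarrow> flip_rows n j f (0, y) = ver f n y"
  using flip_invariant_rows[of n f j] by (simp add: flip_invariant_def)

text \<open>\<open>G(i, j)\<close> as a sum of increments along the bottom axis and then up column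
  \<open>i\<close>.\<close>

definition corner_passage :: "(nat \<times> nat \<Rightarrow> nat) \<Rightarrow> nat \<Rightarrow> nat \<Rightarrow> nat" where
  "corner_passage f i j = (\<Sum>x = 1..i. f (x, 0)) + (\<Sum>y = 1..j. ver f i y)"

lemma corner_passage_Suc_right: "corner_passage f i (Suc j) = corner_passage f i j + ver f i (Suc j)"
  by (simp add: corner_passage_def)

text \<open>Path independence: around a unit cell the two ways to add up increments agree.\<close>

lemma corner_passage_Suc_left: "corner_passage f (Suc i) j = corner_passage f i j + hor f (Suc i) j"
proof (induction j)
  case 0
  then show ?case by (simp add: corner_passage_def)
next
  case (Suc j)
  have "ver f (Suc i) (Suc j) + hor f (Suc i) j = ver f i (Suc j) + hor f (Suc i) (Suc j)"
    by simp
  then show ?case unfolding corner_passage_Suc_right using Suc by linarith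
qed

text \<open>The term \<open>i + j\<close> pays for the \<open>Suc\<close> in the weights: removing
  the corner gives up at most one element of the chain and lets the rectangle lose a row or a
  column.\<close>

lemma pchain_sum_le_corner_passage:
  "C \<subseteq> {1..i} \<times> {1..j} \<Longrightarrow> pchain C \<Longrightarrow>
    (\<Sum>x\<in>C. Suc (f x)) \<le> corner_passage f i j + i + j"
proof (induction "i + j" arbitrary: i j C rule: less_induct)
  case less
  show ?case
  proof (cases "i = 0 \<or> j = 0")
    case True
    then have "C = {}" using less.prems by auto
    then show ?thesis by simp
  next
    case False
    then obtain i' j' where ij: "i = Suc i'" "j = Suc j'" by (metis not0_implies_Suc)
    let ?C = "C - {(i, j)}"
    have finC: "finite C" using less.prems(1) by (meson finite_SigmaI finite_atLeastAtMost finite_subset)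
    have ch: "pchain ?C" using less.prems(2) by (rule pchain_subset) blast
    have sum: "(\<Sum>x\<in>C. Suc (f x)) \<le> (\<Sum>x\<in>?C. Suc (f x)) + Suc (f (i, j))"
      using finC by (cases "(i, j) \<in> C") (simp_all add: sum.remove)
    \<comment> \<open>Otherwise the chain meets both the last column and the last row away from the
      corner, in two incomparable points.\<close>
    have "?C \<subseteq> {1..i'} \<times> {1..j} \<or> ?C \<subseteq> {1..i} \<times> {1..j'}"
    proof (rule ccontr)
      assume "\<not> ?thesis"
      then obtain x y where x: "x \<in> ?C" "x \<notin> {1..i'} \<times> {1..j}" and y: "y \<in> ?C" "y \<notin> {1..i} \<times> {1..j'}"
        by blast
      obtain x1 x2 y1 y2 where xy: "x = (x1, x2)" "y = (y1, y2)" by force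
      have "x1 = i" "x2 < j" "y2 = j" "y1 < i"
        using x y less.prems(1) unfolding xy ij by (auto simp: le_Suc_eq)
      moreover have "below x y \<or> below y x" using ch x y by (auto simp: pchain_def)
      ultimately show False by (auto simp: xy below_def)
    qed
    then show ?thesis
    proof
      assume "?C \<subseteq> {1..i'} \<times> {1..j}"
      then have "(\<Sum>x\<in>?C. Suc (f x)) \<le> corner_passage f i' j + i' + j"
        using less.hyps[of i' j ?C] ch ij by simp
      moreover have "corner_passage f i j = corner_passage f i' j + hor f i j"
        unfolding ij(1) by (rule corner_passage_Suc_left)
      moreover have "f (i, j) \<le> hor f i j" by (simp add: ij)
      ultimately show ?thesis using sum ij by linarith
    next
      assume "?C \<subseteq> {1..i} \<times> {1..j'}"
      then have "(\<Sum>x\<in>?C. Suc (f x)) \<le> corner_passage f i j' + i + j'"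
        using less.hyps[of i j' ?C] ch ij by simp
      moreover have "corner_passage f i j = corner_passage f i j' + ver f i j"
        unfolding ij(2) by (rule corner_passage_Suc_right)
      moreover have "f (i, j) \<le> ver f i j" by (simp add: ij)
      ultimately show ?thesis using sum ij by linarith
    qed
  qed
qed

lemma nn_integral_geometric_pmf:
  assumes "0 \<le> a" "a < 1"
  shows "(\<integral>\<^sup>+k. of_nat k \<partial>geometric_pmf (1 - a)) = ennreal (a / (1 - a))"
proof -
  have r: "1 - a \<in> {0<..1}" using assms by simp
  have "(\<integral>\<^sup>+k. of_nat k \<partial>geometric_pmf (1 - a)) = (\<integral>\<^sup>+k. ennreal (real k) \<partial>geometric_pmf (1 - a))"
    by (simp add: ennreal_of_nat_eq_real_of_nat)
  also have "\<dots> = ennreal (measure_pmf.expectation (geometric_pmf (1 - a)) real)"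
    using integrable_real_geometric_pmf[OF r] by (intro nn_integral_eq_integral) auto
  finally show ?thesis using expectation_geometric_pmf[OF r] by simp
qed

text \<open>The increments up the last column are coordinates of \<open>flip_rows n n f\<close>,
  which has the same law as \<open>f\<close>. Each therefore has the mean of a boundary weight, and
  only expectations are added, so their joint dependence with the bottom axis does not
  matter.\<close>

lemma passage_mean_square_le:
  assumes a: "0 \<le> a" "a < 1" and I: "I \<subseteq> {1..n} \<times> {1..n}"
  shows "passage_mean (1 - a\<^sup>2) I \<le> ennreal (2 * real n / (1 - a))"
proof -
  let ?G = "geometric_pmf (1 - a\<^sup>2)" and ?P = "box_pmf a n"
  have finI: "finite I" using I by (meson finite_SigmaI finite_atLeastAtMost finite_subset)
  have IA: "I \<subseteq> boundary_box n" using I by (auto simp: boundary_box_def)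
  have "Pi_pmf I 0 (\<lambda>_. ?G) = Pi_pmf I 0 (box_law a)"
    using I by (intro Pi_pmf_cong refl) (auto simp: box_law_def)
  also have "\<dots> = map_pmf (\<lambda>f x. if x \<in> I then f x else 0) ?P"
    unfolding box_pmf_def using IA by (intro Pi_pmf_subset) simp
  finally have P: "Pi_pmf I 0 (\<lambda>_. ?G) = map_pmf (\<lambda>f x. if x \<in> I then f x else 0) ?P" .
  have "Pi_pmf I 0 (\<lambda>_. map_pmf Suc ?G) =
      bind_pmf (Pi_pmf I 0 (\<lambda>_. ?G)) (\<lambda>f. Pi_pmf I 0 (\<lambda>x. return_pmf (Suc (f x))))"
    unfolding map_pmf_def by (rule Pi_pmf_bind[OF finI])
  then have law: "Pi_pmf I 0 (\<lambda>_. map_pmf Suc ?G) =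
      map_pmf (\<lambda>f x. if x \<in> I then Suc (f x) else 0) (Pi_pmf I 0 (\<lambda>_. ?G))"
    using finI by (simp add: map_pmf_def)
  have bound: "passage I (\<lambda>x. if x \<in> I then Suc (if x \<in> I then f x else 0) else 0) \<le>
      (\<Sum>x = 1..n. f (x, 0)) + (\<Sum>y = 1..n. flip_rows n n f (0, y)) + 2 * n" for f
  proof (rule passage_leI[OF finI])
    fix C assume C: "C \<subseteq> I" "pchain C"
    have "(\<Sum>x\<in>C. if x \<in> I then Suc (if x \<in> I then f x else 0) else 0) = (\<Sum>x\<in>C. Suc (f x))"
      using C(1) by (intro sum.cong) auto
    also have "\<dots> \<le> corner_passage f n n + n + n"
      using C I by (intro pchain_sum_le_corner_passage) auto
    also have "corner_passage f n n = (\<Sum>x = 1..n. f (x, 0)) + (\<Sum>y = 1..n. flip_rows n n f (0, y))"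
      unfolding corner_passage_def by (simp add: flip_rows_boundary)
    finally show "(\<Sum>x\<in>C. if x \<in> I then Suc (if x \<in> I then f x else 0) else 0) \<le>
      (\<Sum>x = 1..n. f (x, 0)) + (\<Sum>y = 1..n. flip_rows n n f (0, y)) + 2 * n"
      by simp
  qed
  have marg: "(\<integral>\<^sup>+f. of_nat (f z) \<partial>?P) = ennreal (a / (1 - a))"
    if "z \<in> boundary_box n" "fst z = 0 \<or> snd z = 0" for z
  proof -
    have "(\<integral>\<^sup>+f. of_nat (f z) \<partial>?P) = (\<integral>\<^sup>+k. of_nat k \<partial>map_pmf (\<lambda>f. f z) ?P)" by simp
    also have "map_pmf (\<lambda>f. f z) ?P = geometric_pmf (1 - a)"
      unfolding box_pmf_def using that by (simp add: Pi_pmf_component box_law_def)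
    finally show ?thesis using nn_integral_geometric_pmf[OF a] by simp
  qed
  have marg1: "(\<integral>\<^sup>+f. of_nat (f (x, 0)) \<partial>?P) = ennreal (a / (1 - a))" if "x \<in> {1..n}" for x
    using that by (intro marg) (auto simp: boundary_box_def)
  have marg2: "(\<integral>\<^sup>+f. of_nat (flip_rows n n f (0, y)) \<partial>?P) = ennreal (a / (1 - a))" if "y \<in> {1..n}" for y
  proof -
    have "(\<integral>\<^sup>+f. of_nat (flip_rows n n f (0, y)) \<partial>?P) =
        (\<integral>\<^sup>+f. of_nat (f (0, y)) \<partial>map_pmf (flip_rows n n) ?P)" by simp
    also have "\<dots> = ennreal (a / (1 - a))"
      unfolding flip_rows_box_pmf[OF a order_refl] using that
      by (intro marg) (auto simp: boundary_box_def)
    finally show ?thesis .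
  qed
  have "passage_mean (1 - a\<^sup>2) I =
      (\<integral>\<^sup>+f. of_nat (passage I (\<lambda>x. if x \<in> I then Suc (if x \<in> I then f x else 0) else 0)) \<partial>?P)"
    unfolding passage_mean_def law P by simp
  also have "\<dots> \<le> (\<integral>\<^sup>+f. of_nat ((\<Sum>x = 1..n. f (x, 0)) +
      (\<Sum>y = 1..n. flip_rows n n f (0, y)) + 2 * n) \<partial>?P)"
    by (intro nn_integral_mono of_nat_mono bound)
  also have "\<dots> = (\<Sum>x = 1..n. \<integral>\<^sup>+f. of_nat (f (x, 0)) \<partial>?P) +
      (\<Sum>y = 1..n. \<integral>\<^sup>+f. of_nat (flip_rows n n f (0, y)) \<partial>?P) + of_nat (2 * n)"
    by (simp add: nn_integral_add nn_integral_sum)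
  also have "\<dots> = of_nat n * ennreal (a / (1 - a)) + of_nat n * ennreal (a / (1 - a)) + of_nat (2 * n)"
    using marg1 marg2 by simp
  also have "\<dots> = ennreal (real n * (a / (1 - a)) + real n * (a / (1 - a)) + real (2 * n))"
  proof -
    have "of_nat n * ennreal (a / (1 - a)) = ennreal (real n * (a / (1 - a)))"
      unfolding ennreal_of_nat_eq_real_of_nat using a by (subst ennreal_mult) auto
    moreover have "0 \<le> real n * (a / (1 - a))" using a by simp
    ultimately show ?thesis by (simp only: ennreal_of_nat_eq_real_of_nat ennreal_plus of_nat_0_le_iff add_nonneg_nonneg)
  qed
  also have "real n * (a / (1 - a)) + real n * (a / (1 - a)) + real (2 * n) = 2 * real n / (1 - a)"
  proof -
    have "a / (1 - a) = 1 / (1 - a) - 1" using a by (simp add: divide_simps)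
    moreover have "real n * r + real n * r + real (2 * n) = 2 * real n * s" if "r = s - 1" for r s
      by (simp add: that algebra_simps)
    ultimately show ?thesis by fastforce
  qed
  finally show ?thesis .
qed

section \<open>Cambrian lattices of type A\<close>

lemma strict_order_rank:
  assumes fin: "finite S" and x: "x \<in> S" and y: "y \<in> S" and xy: "R x y"
    and irrefl: "\<And>a. a \<in> S \<Longrightarrow> \<not> R a a"
    and trans: "\<And>a b c. a \<in> S \<Longrightarrow> b \<in> S \<Longrightarrow> c \<in> S \<Longrightarrow> R a b \<Longrightarrow> R b c \<Longrightarrow> R a c"
  shows "card {a \<in> S. R a x} < card {a \<in> S. R a y}"
proof (rule psubset_card_mono)
  show "{a \<in> S. R a x} \<subset> {a \<in> S. R a y}"
    using x y xy irrefl trans by blast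
qed (use fin in simp)

lemma strict_order_rank_less:
  assumes fin: "finite S" and x: "x \<in> S" and irrefl: "\<not> R x x"
  shows "card {a \<in> S. R a x} < card S"
  using assms by (intro psubset_card_mono) auto

text \<open>\<open>b\<close> stands before \<open>a\<close> in the one-line notation exactly if \<open>(a, b)\<close> is an inversion, so the
  permutation is read off from the ranks of this linear order.\<close>

lemma permutation_with_inversions:
  assumes sub: "I \<subseteq> {(a, b). 1 \<le> a \<and> a < b \<and> b \<le> Suc n}"
    and tr: "\<And>a b c. (a, b) \<in> I \<Longrightarrow> (b, c) \<in> I \<Longrightarrow> (a, c) \<in> I"
    and cotr: "\<And>a b c. a < b \<Longrightarrow> b < c \<Longrightarrow> (a, c) \<in> I \<Longrightarrow> (a, b) \<in> I \<or> (b, c) \<in> I"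
  shows "\<exists>w \<in> symmetric_group n. inversions w = I"
proof -
  define S where "S = {1..Suc n}"
  define R where "R a b \<longleftrightarrow> (if a < b then (a, b) \<notin> I else a \<noteq> b \<and> (b, a) \<in> I)" for a b
  have irrefl: "\<not> R a a" for a by (simp add: R_def)
  have total: "R a b \<or> R b a" if "a \<noteq> b" for a b
    using that by (auto simp: R_def)
  have trans: "R a c" if "R a b" "R b c" for a b c
  proof -
    have "a \<noteq> b" "b \<noteq> c" using that irrefl by auto
    then consider "a < b \<and> b < c" | "a < c \<and> c < b" | "b < a \<and> a < c" | "b < c \<and> c < a"
      | "c < a \<and> a < b" | "c < b \<and> b < a" | "a = c" by linarith
    then show ?thesis
      by cases (use that tr cotr in \<open>auto simp: R_def split: if_splits; blast\<close>)+
  qed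
  \<comment> \<open>\<open>r a\<close> is the position of the entry \<open>a\<close>, so the
    permutation sought is \<open>inv r\<close>.\<close>
  define r where "r a = (if a \<in> S then Suc (card {x \<in> S. R x a}) else a)" for a
  have finS: "finite S" by (simp add: S_def)
  have less: "r a < r b \<longleftrightarrow> R a b" if "a \<in> S" "b \<in> S" for a b
  proof -
    have mono: "r a < r b" if "R a b" "a \<in> S" "b \<in> S" for a b
      using strict_order_rank[OF finS that(2,3), of R] that irrefl trans
      by (simp add: r_def)
    then show ?thesis
      using mono[OF _ that] mono[OF _ that(2,1)] total[of a b] irrefl
      by (cases "a = b") (auto dest: less_asym)
  qed
  have "inj_on r S"
  proof (rule inj_onI)
    fix a b assume ab: "a \<in> S" "b \<in> S" "r a = r b"
    then show "a = b" using less[OF ab(1,2)] less[OF ab(2,1)] total[of a b] by auto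
  qed
  moreover have "r ` S \<subseteq> S"
  proof
    fix z assume "z \<in> r ` S"
    then obtain a where a: "a \<in> S" "z = r a" by blast
    then have "card {x \<in> S. R x a} < card S"
      using strict_order_rank_less[OF finS a(1), of R] irrefl by blast
    then show "z \<in> S" using a by (simp add: r_def) (simp add: S_def One_nat_def)
  qed
  ultimately have "bij_betw r S S"
    using finS by (simp add: bij_betw_def endo_inj_surj)
  then have r: "r permutes S" by (rule bij_imp_permutes) (simp add: r_def)
  then have w: "inv r \<in> symmetric_group n"
    using permutes_inv[OF r] unfolding symmetric_group_def S_def Suc_eq_plus1 by blast
  have inv_inv: "inv (inv r) = r" using permutes_bij[OF r] by (rule inv_inv_eq)
  have "(a, b) \<in> inversions (inv r) \<longleftrightarrow> (a, b) \<in> I" for a b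
  proof (cases "a < b \<and> a \<in> S \<and> b \<in> S")
    case True
    then have "r b < r a \<longleftrightarrow> (a, b) \<in> I" using less[of b a] by (simp add: R_def)
    then show ?thesis using True by (simp add: in_inversions_iff inv_inv)
  next
    case False
    have "(a, b) \<notin> inversions (inv r)"
      using False inversions_bounds[OF w, of a b] by (auto simp: S_def)
    moreover have "(a, b) \<notin> I" using False sub by (auto simp: S_def)
    ultimately show ?thesis by blast
  qed
  then have "inversions (inv r) = I" by (simp add: set_eq_iff)
  then show ?thesis using w by blast
qed

text \<open>Compresses the keys to \<open>1..card S\<close>, so that the two coordinates fill
  exactly the side \<open>n\<close> of the square.\<close>

definition key_rank :: "nat set \<Rightarrow> (nat \<Rightarrow> nat) \<Rightarrow> nat \<Rightarrow> nat" where
  "key_rank S key x = Suc (card {y \<in> S. key y < key x})"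

lemma key_rank_less:
  assumes "finite S" "x \<in> S" "y \<in> S" "key x < key y"
  shows "key_rank S key x < key_rank S key y"
  using strict_order_rank[OF assms(1-3), of "\<lambda>x y. key x < key y"] assms(4)
  by (simp add: key_rank_def)

lemma key_rank_inj_on:
  assumes "finite S" "inj_on key S"
  shows "inj_on (key_rank S key) S"
proof (rule inj_onI)
  fix x y assume xy: "x \<in> S" "y \<in> S" "key_rank S key x = key_rank S key y"
  then have "key x = key y"
    using key_rank_less[OF assms(1), of x y key] key_rank_less[OF assms(1), of y x key]
    by (metis less_irrefl linorder_neqE_nat)
  then show "x = y" using assms(2) xy by (auto dest: inj_onD)
qed

lemma key_rank_in:
  assumes "finite S" "x \<in> S"
  shows "key_rank S key x \<in> {1..card S}"
  using strict_order_rank_less[OF assms, of "\<lambda>x y. key x < key y"] by (simp add: key_rank_def One_nat_def)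

context coxeter_word
begin

abbreviation lower :: "nat \<Rightarrow> bool" where
  "lower \<equiv> lower_at 0"

definition pairs :: "(nat \<times> nat) set" where
  "pairs = {(a, b). 1 \<le> a \<and> a < b \<and> b \<le> Suc n}"

text \<open>Upper entries come first in decreasing order, then lower ones in increasing order. The
  end entry \<open>1\<close> falls between the two groups under either label.\<close>

definition coord1 :: "nat \<Rightarrow> nat" where
  "coord1 = key_rank {1..n} (\<lambda>a. if lower a then n + 2 + a else n + 1 - a)"

text \<open>Lower entries come first in increasing order, then upper ones in decreasing order. The
  end entry \<open>Suc n\<close> falls between the two groups under either label.\<close>

definition coord2 :: "nat \<Rightarrow> nat" where
  "coord2 = key_rank {2..Suc n} (\<lambda>b. if lower b then b else 2 * n + 4 - b)"

definition coords :: "nat \<times> nat \<Rightarrow> nat \<times> nat" where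
  "coords = map_prod coord1 coord2"

text \<open>An embedding of the heap of the sorting word of the longest element into a square: for fixed
  smaller entry the larger one runs up the lower entries and then down the upper ones, and for fixed
  larger entry the smaller one runs down the upper entries and then up the lower ones.\<close>

lemma coords_lower:
  assumes "1 \<le> a" "a < b" "b < c" "c \<le> Suc n" "lower b"
  shows "coord1 a < coord1 b" "coord2 b < coord2 c"
  unfolding coord1_def coord2_def using assms by (intro key_rank_less; auto)+

lemma coords_upper:
  assumes "1 \<le> a" "a < b" "b < c" "c \<le> Suc n" "\<not> lower b"
  shows "coord1 b < coord1 a" "coord2 c < coord2 b"
  unfolding coord1_def coord2_def using assms by (intro key_rank_less; auto)+

lemma coords_inj_on: "inj_on coords pairs"
proof -
  have "inj_on coord1 {1..n}"
    unfolding coord1_def by (intro key_rank_inj_on inj_onI) (auto split: if_splits)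
  moreover have "inj_on coord2 {2..Suc n}"
    unfolding coord2_def by (intro key_rank_inj_on inj_onI) (auto split: if_splits)
  ultimately have "inj_on coords ({1..n} \<times> {2..Suc n})"
    unfolding coords_def by (rule map_prod_inj_on)
  then show ?thesis by (rule inj_on_subset) (auto simp: pairs_def)
qed

lemma coords_in_square: "coords ` pairs \<subseteq> {1..n} \<times> {1..n}"
proof -
  have "coord1 a \<in> {1..n}" if "a \<in> {1..n}" for a
    using key_rank_in[of "{1..n}" a] that unfolding coord1_def by (metis card_atLeastAtMost finite_atLeastAtMost diff_Suc_1)
  moreover have "coord2 b \<in> {1..n}" if "b \<in> {2..Suc n}" for b
  proof -
    have "card {2..Suc n} = n" by simp
    then show ?thesis using key_rank_in[of "{2..Suc n}" b] that unfolding coord2_def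
      by (metis finite_atLeastAtMost)
  qed
  ultimately show ?thesis by (auto simp: coords_def pairs_def)
qed

definition state :: "(nat \<Rightarrow> nat) \<Rightarrow> (nat \<times> nat) set" where
  "state w = coords ` inversions w"

lemma inversions_subset_pairs: "w \<in> symmetric_group n \<Longrightarrow> inversions w \<subseteq> pairs"
  using inversions_bounds unfolding pairs_def by blast

lemma carrier_Camb:
  "carrier (Camb n cs) = {w \<in> symmetric_group n. aligned lower (inversions w)}"
  by (simp add: Camb_def sortable_iff_aligned)

text \<open>Alignment implies the cotransitivity that, with transitivity, characterizes inversion
  sets, whichever label \<open>b\<close> has.\<close>

lemma Camb_with_inversions:
  assumes "I \<subseteq> pairs" "\<And>a b c. (a, b) \<in> I \<Longrightarrow> (b, c) \<in> I \<Longrightarrow> (a, c) \<in> I" "aligned lower I"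
  shows "\<exists>w \<in> carrier (Camb n cs). inversions w = I"
proof -
  have "\<exists>w \<in> symmetric_group n. inversions w = I"
  proof (rule permutation_with_inversions)
    show "(a, b) \<in> I \<or> (b, c) \<in> I" if "a < b" "b < c" "(a, c) \<in> I" for a b c
      using that assms(3) unfolding aligned_def by metis
  qed (use assms in \<open>auto simp: pairs_def\<close>)
  then show ?thesis using assms(3) by (auto simp: carrier_Camb)
qed

sublocale set_lattice "Camb n cs" state
proof
  let ?C = "carrier (Camb n cs)"
  show "finite ?C"
    by (rule finite_subset[OF _ finite_permutations[of "{1..n + 1}"]])
      (auto simp: carrier_Camb symmetric_group_def)
  show "eq (Camb n cs) = (=)" by (simp add: Camb_def)
  fix x y assume x: "x \<in> ?C" and y: "y \<in> ?C"
  then have sg: "x \<in> symmetric_group n" "y \<in> symmetric_group n"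
    and al: "aligned lower (inversions x)" "aligned lower (inversions y)"
    by (simp_all add: carrier_Camb)
  note sub = inversions_subset_pairs[OF sg(1)] inversions_subset_pairs[OF sg(2)]
  show "x \<sqsubseteq>\<^bsub>Camb n cs\<^esub> y \<longleftrightarrow> state x \<subseteq> state y"
    using right_weak_le_iff_inversions[OF sg] inj_on_image_subset_iff[OF coords_inj_on sub]
    by (simp add: Camb_def state_def)
  show "x = y" if "state x = state y"
    using that inversions_inj[OF sg] inj_on_image_eq_iff[OF coords_inj_on sub]
    by (simp add: state_def)
  have "\<exists>w \<in> ?C. inversions w = inversions x \<inter> inversions y"
  proof (rule Camb_with_inversions)
    show "inversions x \<inter> inversions y \<subseteq> pairs" using sub by blast
    show "(a, c) \<in> inversions x \<inter> inversions y"
      if "(a, b) \<in> inversions x \<inter> inversions y" "(b, c) \<in> inversions x \<inter> inversions y" for a b c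
      using that inversions_trans by blast
    show "aligned lower (inversions x \<inter> inversions y)"
      using al unfolding aligned_def by (metis IntD1 IntD2 IntI)
  qed
  then obtain w where w: "w \<in> ?C" "inversions w = inversions x \<inter> inversions y" by blast
  then have "state w = state x \<inter> state y"
    using inj_on_image_Int[OF coords_inj_on sub] by (simp only: state_def)
  then show "\<exists>z \<in> ?C. state z = state x \<inter> state y" using w(1) by blast
next
  have "\<exists>w \<in> carrier (Camb n cs). inversions w = pairs"
    by (rule Camb_with_inversions) (auto simp: pairs_def aligned_def)
  then obtain t where t: "t \<in> carrier (Camb n cs)" "inversions t = pairs" by blast
  then have "state x \<subseteq> state t" if "x \<in> carrier (Camb n cs)" for x
    using that inversions_subset_pairs by (auto simp: state_def carrier_Camb)
  then show "\<exists>t \<in> carrier (Camb n cs). \<forall>x \<in> carrier (Camb n cs). state x \<subseteq> state t"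
    using t by blast
  have "id \<in> carrier (Camb n cs)"
    unfolding carrier_Camb using id_in_symmetric_group by (auto simp: aligned_def)
  moreover have "state id = {}" by (simp add: state_def)
  ultimately show "\<exists>b \<in> carrier (Camb n cs). state b = {}" by blast
qed

lemma Camb_remove_maximal:
  assumes x: "x \<in> carrier (Camb n cs)" and j: "j \<in> maximals (state x)"
  shows "\<exists>y \<in> carrier (Camb n cs). state y = state x - {j}"
proof -
  let ?I = "inversions x"
  have sg: "x \<in> symmetric_group n" and al: "aligned lower ?I" using x by (simp_all add: carrier_Camb)
  obtain k where k: "k \<in> ?I" "j = coords k" using j by (auto simp: maximals_def state_def)
  have bd: "1 \<le> a \<and> a < b \<and> b \<le> Suc n" if "(a, b) \<in> ?I" for a b
    using inversions_bounds[OF sg that] by blast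
  \<comment> \<open>A pair lying strictly below an inversion in the coordinates is not the deleted
    maximal one. Every pair required by transitivity or alignment is of this kind.\<close>
  have not_k: "(a, b) \<noteq> k"
    if "(c, d) \<in> ?I" "coord1 a \<le> coord1 c" "coord2 b \<le> coord2 d"
      "coord1 a < coord1 c \<or> coord2 b < coord2 d" for a b c d
  proof
    assume "(a, b) = k"
    then have "j = (coord1 a, coord2 b)" using k by (auto simp: coords_def)
    moreover have "(coord1 c, coord2 d) \<in> state x"
      using that(1) unfolding state_def coords_def by (metis imageI map_prod_simp)
    ultimately have "(coord1 c, coord2 d) = (coord1 a, coord2 b)"
      using j that(2,3) unfolding maximals_def below_def by fastforce
    then show False using that(4) by simp
  qed
  have "\<exists>w \<in> carrier (Camb n cs). inversions w = ?I - {k}"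
  proof (rule Camb_with_inversions)
    show "?I - {k} \<subseteq> pairs" using inversions_subset_pairs[OF sg] by blast
    show "(a, c) \<in> ?I - {k}" if ab: "(a, b) \<in> ?I - {k}" and bc: "(b, c) \<in> ?I - {k}" for a b c
    proof -
      have "(a, c) \<in> ?I" using ab bc inversions_trans by blast
      moreover have "(a, c) \<noteq> k"
      proof (cases "lower b")
        case True
        then show ?thesis
          using not_k[of b c a c] coords_lower[of a b c] ab bc bd[of a b] bd[of b c] by simp
      next
        case False
        then show ?thesis
          using not_k[of a b a c] coords_upper[of a b c] ab bc bd[of a b] bd[of b c] by simp
      qed
      ultimately show ?thesis by simp
    qed
    show "aligned lower (?I - {k})"
      unfolding aligned_def
    proof (intro allI impI)
      fix a b c assume abc: "a < b" "b < c" and "(a, c) \<in> ?I - {k}"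
      then have ac: "(a, c) \<in> ?I" by simp
      have i: "if lower b then (a, b) \<in> ?I else (b, c) \<in> ?I"
        using al abc ac unfolding aligned_def by blast
      show "if lower b then (a, b) \<in> ?I - {k} else (b, c) \<in> ?I - {k}"
        using i not_k[OF ac, of a b] not_k[OF ac, of b c] coords_lower[of a b c] coords_upper[of a b c]
          abc bd[OF ac] by (simp split: if_splits)
    qed
  qed
  moreover have "coords ` (?I - {k}) = state x - {j}"
  proof -
    have "coords ` (?I - {k}) = coords ` ?I - coords ` {k}"
      using k inversions_subset_pairs[OF sg] by (intro inj_on_image_set_diff[OF coords_inj_on]) auto
    then show ?thesis by (simp add: state_def k)
  qed
  ultimately show ?thesis unfolding state_def by metis
qed

lemma state_subset_square: "x \<in> carrier (Camb n cs) \<Longrightarrow> state x \<subseteq> {1..n} \<times> {1..n}"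
  using coords_in_square inversions_subset_pairs unfolding state_def carrier_Camb by blast

text \<open>The potential is \<open>passage_mean p\<close>, and the elements deleted one at a time
  are the maximal elements of the state.\<close>

lemma expected_steps_Camb_le:
  assumes p: "0 < p" "p \<le> 1"
  shows "expected_steps p (Camb n cs) \<le> ennreal (2 * real n / (1 - sqrt (1 - p)))"
proof -
  have fin: "finite (state x)" if "x \<in> carrier (Camb n cs)" for x
    using state_subset_square[OF that] by (meson finite_SigmaI finite_atLeastAtMost finite_subset)
  have "expected_steps p (Camb n cs) \<le> passage_mean p (state \<top>\<^bsub>Camb n cs\<^esub>)"
  proof (rule expected_steps_le_potential[where D = "\<lambda>x. maximals (state x)"])
    show "j \<in> state x \<and> (\<exists>y \<in> carrier (Camb n cs). state y = state x - {j})"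
      if "x \<in> carrier (Camb n cs)" "j \<in> maximals (state x)" for x j
      using that Camb_remove_maximal[OF that] by (auto simp: maximals_def)
  qed (use fin passage_mean_mono passage_mean_step[OF p] in auto)
  also have "\<dots> \<le> ennreal (2 * real n / (1 - sqrt (1 - p)))"
    using passage_mean_square_le[of "sqrt (1 - p)" "state \<top>\<^bsub>Camb n cs\<^esub>" n] p
      state_subset_square[OF top_props(1)] by simp
  finally show ?thesis .
qed

end

theorem theorem1p14:
  fixes p :: real
    and c :: "nat \<Rightarrow> nat \<Rightarrow> nat"
    and cs :: "nat \<Rightarrow> nat list"
  assumes "0 < p" and "p \<le> 1"
    and "\<And>n. n \<ge> 1 \<Longrightarrow> c n \<in> coxeter_elements n"
    and "\<And>n. n \<ge> 1 \<Longrightarrow> cs n \<in> coxeter_words n (c n)"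
  shows "\<exists>f :: nat \<Rightarrow> real. f \<in> o(\<lambda>n. real n) \<and>
    (\<forall>n\<ge>1. enn2ereal (expected_steps p (Camb n (cs n)))
            \<le> ereal (1 / p * (2 + 2 * sqrt (1 - p)) * real n + f n))"
proof (intro exI[of _ "\<lambda>_. 0"] conjI allI impI)
  show "(\<lambda>_. 0) \<in> o(\<lambda>n. real n)" by simp
  fix n :: nat assume n: "1 \<le> n"
  interpret coxeter_word n "cs n"
    using assms(4)[OF n] n by unfold_locales (auto simp: coxeter_words_def)
  let ?a = "sqrt (1 - p)"
  have a: "0 \<le> ?a" "?a < 1" "?a * ?a = 1 - p" using assms(1,2) by simp_all
  then have "(1 - ?a) * (1 + ?a) = p" by (simp add: algebra_simps)
  then have "1 / (1 - ?a) = (1 + ?a) / p"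
    using a assms(1) by (simp add: divide_simps mult.commute)
  then have eq: "2 * real n / (1 - ?a) = 1 / p * (2 + 2 * ?a) * real n"
    using a assms(1) by (simp add: field_simps)
  have "enn2ereal (expected_steps p (Camb n (cs n))) \<le> enn2ereal (ennreal (2 * real n / (1 - ?a)))"
    using expected_steps_Camb_le[OF assms(1,2)] by (simp add: less_eq_ennreal.rep_eq)
  also have "\<dots> = ereal (1 / p * (2 + 2 * ?a) * real n + 0)"
    using a assms(1) by (simp add: eq enn2ereal_ennreal)
  finally show "enn2ereal (expected_steps p (Camb n (cs n))) \<le>
      ereal (1 / p * (2 + 2 * ?a) * real n + 0)" .
qed

end
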